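(* Let $p=m$ and $1\le r\le\min(q,n)$. The vector $$\Gamma_r=\sum_{D}(-1)^{\frac12|D|(|D|-1)}\Delta_D,$$ where the summation ranges over all marked $m\times r$ diagrams $D$, is a $gl(m|q)\times gl(m|n)$ highest weight vector in $\mathbb{C}[\mathbf{x},\boldsymbol{\xi},\boldsymbol{\eta},\mathbf{y}]$ corresponding to the rectangular Young diagram of length $m+1$ and width $r$.
   Context: $\mathbb{C}[\mathbf{x},\boldsymbol{\xi},\boldsymbol{\eta},\mathbf{y}]$ is the polynomial superalgebra over $\mathbb{C}$ in even variables $x_l^i$ ($1\le i\le p$, $1\le l\le m$), $y_k^j$ ($1\le j\le q$, $1\le k\le n$) and odd variables $\xi_l^j$ ($1\le j\le q$, $1\le l\le m$), $\eta_k^i$ ($1\le i\le p$, $1\le k\le n$); here $p=m$. It is identified with the (super)symmetric algebra $S(\mathbb{C}^{p|q}\otimes\mathbb{C}^{m|n})$ via $x_l^i=e_l\otimes e^i$, $\xi_l^j=e_l\otimes f^j$, $\eta_k^i=f_k\otimes e^i$, $y_k^j=f_k\otimes f^j$, where $e^i;f^j$ and $e_l;f_k$ are the standard (even; odd) bases of $\mathbb{C}^{p|q}$ and $\mathbb{C}^{m|n}$. Cartan subalgebras: for $gl(p|q)$, $\sum_{j=1}^m x_j^i\frac{\partial}{\partial x_j^i}+\sum_{j=1}^n\eta_j^i\frac{\partial}{\partial\eta_j^i}$ ($1\le i\le p$) and $\sum_{j=1}^m\xi_j^l\frac{\partial}{\partial\xi_j^l}+\sum_{j=1}^n y_j^l\frac{\partial}{\partial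 y_j^l}$ ($1\le l\le q$); for $gl(m|n)$, $\sum_{j=1}^p x_s^j\frac{\partial}{\partial x_s^j}+\sum_{j=1}^q\xi_s^j\frac{\partial}{\partial\xi_s^j}$ ($1\le s\le m$) and $\sum_{j=1}^p\eta_k^j\frac{\partial}{\partial\eta_k^j}+\sum_{j=1}^q y_k^j\frac{\partial}{\partial y_k^j}$ ($1\le k\le n$). Simple root vectors: for $gl(p|q)$, $\sum_j x_j^{i-1}\frac{\partial}{\partial x_j^i}+\sum_j\eta_j^{i-1}\frac{\partial}{\partial\eta_j^i}$ ($1<i\le p$), $\sum_j\xi_j^{l-1}\frac{\partial}{\partial\xi_j^l}+\sum_j y_j^{l-1}\frac{\partial}{\partial y_j^l}$ ($1<l\le q$), $\sum_j x_j^p\frac{\partial}{\partial\xi_j^1}+\sum_j\eta_j^p\frac{\partial}{\partial y_j^1}$; for $gl(m|n)$, $\sum_j x_{s-1}^j\frac{\partial}{\partial x_s^j}+\sum_j\xi_{s-1}^j\frac{\partial}{\partial\xi_s^j}$ ($1<s\le m$), $\sum_j\eta_{k-1}^j\frac{\partial}{\partial\eta_k^j}+\sum_j y_{k-1}^j\frac{\partial}{\partial y_k^j}$ ($1<k\le n$), $\sum_j x_m^j\frac{\partial}{\partial\eta_1^j}-\sum_j\xi_m^j\frac{\partial}{\partial y_1^j}$. A highest weight vector is a nonzero weight vector annihilated by all simple root vectors of both algebras. It corresponds to the Young diagram $\lambda$ if its $gl(p|q)$-weight is $(\lambda_1,\ldots,\lambda_p;\langle\lambda'_1-p\rangle,\ldots,\langle\lambda'_q-p\rangle)$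 and its $gl(m|n)$-weight is $(\lambda_1,\ldots,\lambda_m;\langle\lambda'_1-m\rangle,\ldots,\langle\lambda'_n-m\rangle)$, where $\lambda'$ is the transpose and $\langle l\rangle=\max(l,0)$. Determinants of matrices with entries in a superalgebra ($a_i^j$ in row $i$, column $j$) are $\det=\sum_{\sigma}\mathrm{sgn}(\sigma)a_1^{\sigma(1)}a_2^{\sigma(2)}\cdots$ (row order). Let $X$ be the $m\times m$ matrix with $l$-th row $(x_l^1,\ldots,x_l^m)$ and $Y$ the $r\times r$ matrix with $k$-th row $(y_k^1,\ldots,y_k^r)$. A marked $m\times r$ diagram $D$ is a rectangle of $m$ rows and $r$ columns of boxes, some of which are marked, with at most one marked box in each column; $|D|$ is the number of marked boxes. $Y_D$ is obtained from $Y$ by replacing, for each marked box in column $i$ and row $j$, the $i$-th row of $Y$ by $(\xi_j^1,\ldots,\xi_j^r)$. For $1\le i\le r$, $X_i=X$ if column $i$ of $D$ has no marked box; if it is marked in row $j$, $X_i$ is obtained from $X$ by replacing its $j$-th row by $(\eta_i^1,\ldots,\eta_i^m)$. Put $\det X_D:=\det X_1\det X_2\cdots\det X_r$ (in this order) and $\Delta_D:=\det X_D\,\det Y_D$. *)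

theory Defs
  imports Complex_Main "HOL-Library.Nat_Bijection" "HOL-Library.Poly_Mapping" "HOL-Combinatorics.Permutations"
begin

section \<open>The Grassmann algebra over a commutative ring\<close>

text \<open>
  The exterior algebra over the commutative ring \<open>'r\<close> on a linearly ordered set of odd
  generators \<open>'o\<close>.  An element is a finite combination of the ordered monomials
  \<open>\<theta>\<^bsub>s1\<^esub> \<theta>\<^bsub>s2\<^esub> \<dots> \<theta>\<^bsub>sk\<^esub>\<close> with \<open>s1 < s2 < \<dots> < sk\<close>, indexed by the finite set
  \<open>S = {s1, \<dots>, sk}\<close>.
\<close>

typedef (overloaded) ('o, 'r) grassmann =
  "{f :: 'o set \<Rightarrow> 'r::zero. finite {S. f S \<noteq> 0} \<and> (\<forall>S. f S \<noteq> 0 \<longrightarrow> finite S)}"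
  morphisms gcoeff Abs_grassmann
  by (rule exI[of _ "\<lambda>_. 0"]) simp

setup_lifting type_definition_grassmann

text \<open>
  The sign of reordering the monomial of \<open>S\<close> followed by the monomial of \<open>T\<close>
  (for disjoint \<open>S\<close>, \<open>T\<close>) into the monomial of \<open>S \<union> T\<close>.
\<close>

definition gsign :: "'o::linorder set \<Rightarrow> 'o set \<Rightarrow> 'r::ring_1"
  where "gsign S T = (- 1) ^ card {(s, t). s \<in> S \<and> t \<in> T \<and> t < s}"

lemma gsign_empty [simp]: "gsign {} T = 1" "gsign S {} = 1"
  by (simp_all add: gsign_def)

lemma gsign_Un_left:
  assumes "finite S" "finite T" "finite W" "S \<inter> T = {}"
  shows "gsign (S \<union> T) W = (gsign S W * gsign T W :: 'r::ring_1)"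
proof -
  let ?I = "\<lambda>A. {(s, t). s \<in> A \<and> t \<in> W \<and> t < s}"
  have fin: "finite (?I A)" if "finite A" for A
    by (rule finite_subset[of _ "A \<times> W"]) (use that assms(3) in auto)
  have "card (?I (S \<union> T)) = card (?I S \<union> ?I T)"
    by (rule arg_cong[of _ _ card]) auto
  also have "\<dots> = card (?I S) + card (?I T)"
    using assms(4) by (intro card_Un_disjoint fin assms) auto
  finally show ?thesis by (simp add: gsign_def power_add)
qed

lemma gsign_Un_right:
  assumes "finite S" "finite T" "finite W" "S \<inter> T = {}"
  shows "gsign W (S \<union> T) = (gsign W S * gsign W T :: 'r::ring_1)"
proof -
  let ?I = "\<lambda>A. {(s, t). s \<in> W \<and> t \<in> A \<and> t < s}"
  have fin: "finite (?I A)" if "finite A" for A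
    by (rule finite_subset[of _ "W \<times> A"]) (use that assms(3) in auto)
  have "card (?I (S \<union> T)) = card (?I S \<union> ?I T)"
    by (rule arg_cong[of _ _ card]) auto
  also have "\<dots> = card (?I S) + card (?I T)"
    using assms(4) by (intro card_Un_disjoint fin assms) auto
  finally show ?thesis by (simp add: gsign_def power_add)
qed

definition gmul ::
    "('o::linorder set \<Rightarrow> 'r::comm_ring_1) \<Rightarrow> ('o set \<Rightarrow> 'r) \<Rightarrow> 'o set \<Rightarrow> 'r"
  where "gmul f g U = (\<Sum>S\<in>Pow U. gsign S (U - S) * f S * g (U - S))"

lemma gmul_infinite: "infinite U \<Longrightarrow> gmul f g U = 0"
  by (simp add: gmul_def)

lemma gmul_support:
  assumes "gmul f g U \<noteq> 0"
  shows "finite U" "\<exists>S T. f S \<noteq> 0 \<and> g T \<noteq> 0 \<and> U = S \<union> T"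
proof -
  show "finite U" using assms gmul_infinite by blast
  obtain S where "S \<in> Pow U" "gsign S (U - S) * f S * g (U - S) \<noteq> 0"
    using assms unfolding gmul_def by (meson sum.not_neutral_contains_not_neutral)
  then show "\<exists>S T. f S \<noteq> 0 \<and> g T \<noteq> 0 \<and> U = S \<union> T"
    by (intro exI[of _ S] exI[of _ "U - S"]) auto
qed

lemma gmul_assoc:
  fixes f g h :: "'o::linorder set \<Rightarrow> 'r::comm_ring_1"
  shows "gmul (gmul f g) h U = gmul f (gmul g h) U"
proof (cases "finite U")
  case fin: True
  define F where "F S T W =
    gsign S T * gsign S W * gsign T W * f S * g T * h W" for S T W
  have "gmul (gmul f g) h U = (\<Sum>V\<in>Pow U. \<Sum>S\<in>Pow V. F S (V - S) (U - V))"
    unfolding gmul_def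
  proof (intro sum.cong refl)
    fix V assume "V \<in> Pow U"
    then have V: "V \<subseteq> U" by simp
    have "gsign V (U - V) * (gsign S (V - S) * f S * g (V - S)) * h (U - V)
        = F S (V - S) (U - V)" if "S \<in> Pow V" for S
    proof -
      have "gsign (S \<union> (V - S)) (U - V) = (gsign S (U - V) * gsign (V - S) (U - V) :: 'r)"
        using that V fin by (intro gsign_Un_left) (auto intro: finite_subset)
      moreover have "S \<union> (V - S) = V" using that by auto
      ultimately show ?thesis by (simp add: F_def mult_ac)
    qed
    then show "gsign V (U - V) * (\<Sum>S\<in>Pow V. gsign S (V - S) * f S * g (V - S)) * h (U - V)
        = (\<Sum>S\<in>Pow V. F S (V - S) (U - V))"
      by (simp add: sum_distrib_left sum_distrib_right)
  qed
  also have "\<dots> = (\<Sum>(V, S)\<in>(SIGMA V:Pow U. Pow V). F S (V - S) (U - V))"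
    using fin by (subst sum.Sigma) (auto intro: finite_subset)
  also have "\<dots> = (\<Sum>(S, T)\<in>(SIGMA S:Pow U. Pow (U - S)). F S T (U - S - T))"
  proof (rule sum.reindex_bij_witness[of _ "\<lambda>(S, T). (S \<union> T, S)" "\<lambda>(V, S). (S, V - S)"],
      goal_cases)
    case (5 a)
    then obtain V S where a: "a = (V, S)" and "S \<subseteq> V" by auto
    then have "U - S - (V - S) = U - V" by auto
    then show ?case by (simp add: a)
  qed auto
  also have "\<dots> = (\<Sum>S\<in>Pow U. \<Sum>T\<in>Pow (U - S). F S T (U - S - T))"
    using fin by (subst sum.Sigma) (auto intro: finite_subset)
  also have "\<dots> = gmul f (gmul g h) U"
    unfolding gmul_def
  proof (intro sum.cong refl)
    fix S assume "S \<in> Pow U"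
    then have S: "S \<subseteq> U" by simp
    have "gsign S (U - S) * f S * (gsign T (U - S - T) * g T * h (U - S - T))
        = F S T (U - S - T)" if "T \<in> Pow (U - S)" for T
    proof -
      have "gsign S (T \<union> (U - S - T)) = (gsign S T * gsign S (U - S - T) :: 'r)"
        using that S fin by (intro gsign_Un_right) (auto intro: finite_subset)
      moreover have "T \<union> (U - S - T) = U - S" using that by auto
      ultimately show ?thesis by (simp add: F_def mult_ac)
    qed
    then show "(\<Sum>T\<in>Pow (U - S). F S T (U - S - T))
        = gsign S (U - S) * f S
          * (\<Sum>T\<in>Pow (U - S). gsign T (U - S - T) * g T * h (U - S - T))"
      by (simp add: sum_distrib_left)
  qed
  finally show ?thesis .
qed (simp add: gmul_infinite)

instantiation grassmann :: (linorder, comm_ring_1) ring_1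
begin

lift_definition zero_grassmann :: "('a, 'b) grassmann" is "\<lambda>_. 0"
  by simp

lift_definition one_grassmann :: "('a, 'b) grassmann" is "\<lambda>U. if U = {} then 1 else 0"
  by simp

lift_definition uminus_grassmann :: "('a, 'b) grassmann \<Rightarrow> ('a, 'b) grassmann"
  is "\<lambda>f U. - f U"
  by simp

lift_definition plus_grassmann ::
    "('a, 'b) grassmann \<Rightarrow> ('a, 'b) grassmann \<Rightarrow> ('a, 'b) grassmann"
  is "\<lambda>f g U. f U + g U"
proof -
  fix f g :: "'a set \<Rightarrow> 'b"
  assume f: "finite {S. f S \<noteq> 0} \<and> (\<forall>S. f S \<noteq> 0 \<longrightarrow> finite S)"
    and g: "finite {S. g S \<noteq> 0} \<and> (\<forall>S. g S \<noteq> 0 \<longrightarrow> finite S)"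
  have "finite {S. f S + g S \<noteq> 0}"
    by (rule finite_subset[of _ "{S. f S \<noteq> 0} \<union> {S. g S \<noteq> 0}"]) (use f g in auto)
  moreover have "\<forall>S. f S + g S \<noteq> 0 \<longrightarrow> finite S"
    using f g by (metis add.right_neutral)
  ultimately show "finite {S. f S + g S \<noteq> 0} \<and> (\<forall>S. f S + g S \<noteq> 0 \<longrightarrow> finite S)" ..
qed

definition minus_grassmann ::
    "('a, 'b) grassmann \<Rightarrow> ('a, 'b) grassmann \<Rightarrow> ('a, 'b) grassmann"
  where "f - g = f + - (g :: ('a, 'b) grassmann)"

lift_definition times_grassmann ::
    "('a, 'b) grassmann \<Rightarrow> ('a, 'b) grassmann \<Rightarrow> ('a, 'b) grassmann"
  is gmul
proof -
  fix f g :: "'a set \<Rightarrow> 'b"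
  assume f: "finite {S. f S \<noteq> 0} \<and> (\<forall>S. f S \<noteq> 0 \<longrightarrow> finite S)"
    and g: "finite {S. g S \<noteq> 0} \<and> (\<forall>S. g S \<noteq> 0 \<longrightarrow> finite S)"
  have "{U. gmul f g U \<noteq> 0}
      \<subseteq> (\<lambda>(S, T). S \<union> T) ` ({S. f S \<noteq> 0} \<times> {T. g T \<noteq> 0})"
    using gmul_support(2)[of f g] by fastforce
  then have "finite {U. gmul f g U \<noteq> 0}"
    using f g by (meson finite_SigmaI finite_imageI finite_subset)
  then show "finite {U. gmul f g U \<noteq> 0} \<and> (\<forall>U. gmul f g U \<noteq> 0 \<longrightarrow> finite U)"
    using gmul_support(1) by blast
qed

instance
proof
  fix a b c :: "('a, 'b) grassmann"
  show "a + b + c = a + (b + c)" by transfer (simp add: add.assoc)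
  show "a + b = b + a" by transfer (simp add: add.commute)
  show "0 + a = a" by transfer simp
  show "- a + a = 0" by transfer simp
  show "a - b = a + - b" by (simp add: minus_grassmann_def)
  show "a * b * c = a * (b * c)" by transfer (rule ext, rule gmul_assoc)
  show "(a + b) * c = a * c + b * c"
    by transfer (simp add: fun_eq_iff gmul_def algebra_simps sum.distrib)
  show "a * (b + c) = a * b + a * c"
    by transfer (simp add: fun_eq_iff gmul_def algebra_simps sum.distrib)
  show "(0 :: ('a, 'b) grassmann) \<noteq> 1"
    by transfer (auto simp: fun_eq_iff)
  show "1 * a = a"
  proof (transfer, rule ext)
    fix f :: "'a set \<Rightarrow> 'b" and U
    assume f: "finite {S. f S \<noteq> 0} \<and> (\<forall>S. f S \<noteq> 0 \<longrightarrow> finite S)"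
    have "gmul (\<lambda>V. if V = {} then 1 else 0) f U = (\<Sum>S\<in>Pow U. if S = {} then f U else 0)"
      unfolding gmul_def by (intro sum.cong) auto
    also have "\<dots> = f U"
      using f by (cases "finite U") auto
    finally show "gmul (\<lambda>V. if V = {} then 1 else 0) f U = f U" .
  qed
  show "a * 1 = a"
  proof (transfer, rule ext)
    fix f :: "'a set \<Rightarrow> 'b" and U
    assume f: "finite {S. f S \<noteq> 0} \<and> (\<forall>S. f S \<noteq> 0 \<longrightarrow> finite S)"
    have "gmul f (\<lambda>V. if V = {} then 1 else 0) U = (\<Sum>S\<in>Pow U. if S = U then f U else 0)"
      unfolding gmul_def by (intro sum.cong) auto
    also have "\<dots> = f U"
      using f by (cases "finite U") auto
    finally show "gmul f (\<lambda>V. if V = {} then 1 else 0) U = f U" .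
  qed
qed

end

lift_definition gconst :: "'r::zero \<Rightarrow> ('o, 'r) grassmann"
  is "\<lambda>c U. if U = {} then c else 0"
  by simp

lift_definition godd :: "'o \<Rightarrow> ('o, 'r::zero_neq_one) grassmann"
  is "\<lambda>v U. if U = {v} then 1 else 0"
  by simp

lemma godd_anticommute:
  "godd v * godd w = - (godd w * godd v :: ('o::linorder, 'r::comm_ring_1) grassmann)"
proof (transfer, rule ext)
  fix v w :: 'o and U
  have *: "gmul (\<lambda>U. if U = {a} then 1 else 0) (\<lambda>U. if U = {b} then 1 else 0) U
      = (if a \<noteq> b \<and> U = {a, b} then if b < a then - 1 else 1 else (0 :: 'r))" for a b :: 'o
  proof (cases "finite U")
    case True
    have "gmul (\<lambda>U. if U = {a} then 1 else 0) (\<lambda>U. if U = {b} then 1 else 0) U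
        = (\<Sum>S\<in>Pow U. if S = {a} then if U - {a} = {b} then gsign {a} {b} else 0 else (0 :: 'r))"
      unfolding gmul_def by (intro sum.cong) auto
    also have "\<dots> = (if a \<in> U \<and> U - {a} = {b} then gsign {a} {b} else 0)"
      using True by (simp add: sum.delta)
    also have "(a \<in> U \<and> U - {a} = {b}) = (a \<noteq> b \<and> U = {a, b})" by auto
    also have "gsign {a} {b} = (if b < a then - 1 else (1 :: 'r))"
    proof -
      have "{(s, t). s \<in> {a} \<and> t \<in> {b} \<and> t < s} = (if b < a then {(a, b)} else {})" by auto
      then show ?thesis by (simp add: gsign_def)
    qed
    finally show ?thesis .
  qed (auto simp: gmul_infinite)
  show "gmul (\<lambda>U. if U = {v} then 1 else 0) (\<lambda>U. if U = {w} then 1 else 0) U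
      = - gmul (\<lambda>U. if U = {w} then 1 else 0) (\<lambda>U. if U = {v} then 1 else (0 :: 'r)) U"
    unfolding * by (auto simp: insert_commute)
qed

text \<open>
  The left partial derivative with respect to the odd generator \<open>v\<close>: it sends
  \<open>\<theta>\<^bsub>v\<^esub> \<cdot> M\<close> to \<open>M\<close> and kills \<open>M\<close>, for every monomial \<open>M\<close> not involving \<open>v\<close>.
\<close>

lift_definition godd_deriv ::
    "'o::linorder \<Rightarrow> ('o, 'r::comm_ring_1) grassmann \<Rightarrow> ('o, 'r) grassmann"
  is "\<lambda>v f U. if v \<in> U then 0 else gsign {v} U * f (insert v U)"
proof -
  fix v :: 'o and f :: "'o set \<Rightarrow> 'r"
  assume f: "finite {S. f S \<noteq> 0} \<and> (\<forall>S. f S \<noteq> 0 \<longrightarrow> finite S)"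
  let ?h = "\<lambda>U. if v \<in> U then 0 else gsign {v} U * f (insert v U)"
  have "{U. ?h U \<noteq> 0} \<subseteq> (\<lambda>S. S - {v}) ` {S. f S \<noteq> 0}"
  proof
    fix U assume "U \<in> {U. ?h U \<noteq> 0}"
    then have "v \<notin> U" "f (insert v U) \<noteq> 0" by (auto split: if_splits)
    then show "U \<in> (\<lambda>S. S - {v}) ` {S. f S \<noteq> 0}"
      by (intro image_eqI[of _ _ "insert v U"]) auto
  qed
  then have "finite {U. ?h U \<noteq> 0}"
    using f by (meson finite_imageI finite_subset)
  moreover have "\<forall>U. ?h U \<noteq> 0 \<longrightarrow> finite U"
    using f by (metis finite_insert mult_zero_right)
  ultimately show "finite {U. ?h U \<noteq> 0} \<and> (\<forall>U. ?h U \<noteq> 0 \<longrightarrow> finite U)" ..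
qed

lift_definition gmap :: "('r::zero \<Rightarrow> 'r) \<Rightarrow> ('o, 'r) grassmann \<Rightarrow> ('o, 'r) grassmann"
  is "\<lambda>d f U. if f U = 0 then 0 else d (f U)"
  by (auto elim: finite_subset[rotated])


section \<open>The polynomial superalgebra\<close>

text \<open>
  The lower index comes first: \<open>EvX l i\<close>, \<open>EvY k j\<close>, \<open>OdXi l j\<close>, \<open>OdEta k i\<close> stand for
  \<open>x_l^i\<close>, \<open>y_k^j\<close>, \<open>\<xi>_l^j\<close>, \<open>\<eta>_k^i\<close>.  Indices start at 1.
\<close>

datatype evar = EvX nat nat | EvY nat nat

datatype ovar = OdXi nat nat | OdEta nat nat

text \<open>
  Any linear order on the odd variables would do: it only selects the ordered monomials
  that represent elements of the superalgebra.
\<close>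

fun ovar_key :: "ovar \<Rightarrow> nat"
  where
    "ovar_key (OdXi l j) = 2 * prod_encode (l, j)"
  | "ovar_key (OdEta k i) = 2 * prod_encode (k, i) + 1"

lemma ovar_key_inject: "ovar_key a = ovar_key b \<longleftrightarrow> a = b"
  by (cases a; cases b) (auto, presburger+)

instantiation ovar :: linorder
begin

definition less_eq_ovar :: "ovar \<Rightarrow> ovar \<Rightarrow> bool"
  where "a \<le> b \<longleftrightarrow> ovar_key a \<le> ovar_key b"

definition less_ovar :: "ovar \<Rightarrow> ovar \<Rightarrow> bool"
  where "a < b \<longleftrightarrow> ovar_key a < ovar_key b"

instance
  by standard (auto simp: less_eq_ovar_def less_ovar_def ovar_key_inject)

end

type_synonym evpoly = "(evar \<Rightarrow>\<^sub>0 nat) \<Rightarrow>\<^sub>0 complex"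

type_synonym superpoly = "(ovar, evpoly) grassmann"

definition scal :: "complex \<Rightarrow> superpoly"
  where "scal c = gconst (Poly_Mapping.single 0 c)"

definition evgen :: "evar \<Rightarrow> superpoly"
  where "evgen v = gconst (Poly_Mapping.single (Poly_Mapping.single v 1) 1)"

definition xv :: "nat \<Rightarrow> nat \<Rightarrow> superpoly"
  where "xv l i = evgen (EvX l i)"

definition yv :: "nat \<Rightarrow> nat \<Rightarrow> superpoly"
  where "yv k j = evgen (EvY k j)"

definition xiv :: "nat \<Rightarrow> nat \<Rightarrow> superpoly"
  where "xiv l j = godd (OdXi l j)"

definition etav :: "nat \<Rightarrow> nat \<Rightarrow> superpoly"
  where "etav k i = godd (OdEta k i)"

definition evpoly_deriv :: "evar \<Rightarrow> evpoly \<Rightarrow> evpoly"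
  where "evpoly_deriv v f =
    (\<Sum>a\<in>Poly_Mapping.keys f.
      Poly_Mapping.single (a - Poly_Mapping.single v 1)
        (of_nat (Poly_Mapping.lookup a v) * Poly_Mapping.lookup f a))"

definition dx :: "nat \<Rightarrow> nat \<Rightarrow> superpoly \<Rightarrow> superpoly"
  where "dx l i = gmap (evpoly_deriv (EvX l i))"

definition dy :: "nat \<Rightarrow> nat \<Rightarrow> superpoly \<Rightarrow> superpoly"
  where "dy k j = gmap (evpoly_deriv (EvY k j))"

definition dxi :: "nat \<Rightarrow> nat \<Rightarrow> superpoly \<Rightarrow> superpoly"
  where "dxi l j = godd_deriv (OdXi l j)"

definition deta :: "nat \<Rightarrow> nat \<Rightarrow> superpoly \<Rightarrow> superpoly"
  where "deta k i = godd_deriv (OdEta k i)"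

text \<open>
  The type \<^typ>\<open>superpoly\<close> has a variable for every pair of indices;
  \<open>superpolys p q m n\<close> is the superalgebra in the variables within the index bounds.
\<close>

definition evars :: "nat \<Rightarrow> nat \<Rightarrow> nat \<Rightarrow> nat \<Rightarrow> evar set"
  where "evars p q m n =
    {EvX l i | l i. l \<in> {1..m} \<and> i \<in> {1..p}} \<union> {EvY k j | k j. k \<in> {1..n} \<and> j \<in> {1..q}}"

definition ovars :: "nat \<Rightarrow> nat \<Rightarrow> nat \<Rightarrow> nat \<Rightarrow> ovar set"
  where "ovars p q m n =
    {OdXi l j | l j. l \<in> {1..m} \<and> j \<in> {1..q}} \<union> {OdEta k i | k i. k \<in> {1..n} \<and> i \<in> {1..p}}"

definition superpolys :: "nat \<Rightarrow> nat \<Rightarrow> nat \<Rightarrow> nat \<Rightarrow> superpoly set"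
  where "superpolys p q m n =
    {f. \<forall>U. gcoeff f U \<noteq> 0 \<longrightarrow>
          U \<subseteq> ovars p q m n \<and>
          (\<forall>a\<in>Poly_Mapping.keys (gcoeff f U). Poly_Mapping.keys a \<subseteq> evars p q m n)}"


section \<open>The actions of \<open>gl(p|q)\<close> and \<open>gl(m|n)\<close>\<close>

definition pq_cartan_even :: "nat \<Rightarrow> nat \<Rightarrow> nat \<Rightarrow> superpoly \<Rightarrow> superpoly"
  where "pq_cartan_even m n i f =
    (\<Sum>j=1..m. xv j i * dx j i f) + (\<Sum>j=1..n. etav j i * deta j i f)"

definition pq_cartan_odd :: "nat \<Rightarrow> nat \<Rightarrow> nat \<Rightarrow> superpoly \<Rightarrow> superpoly"
  where "pq_cartan_odd m n l f =
    (\<Sum>j=1..m. xiv j l * dxi j l f) + (\<Sum>j=1..n. yv j l * dy j l f)"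

definition mn_cartan_even :: "nat \<Rightarrow> nat \<Rightarrow> nat \<Rightarrow> superpoly \<Rightarrow> superpoly"
  where "mn_cartan_even p q s f =
    (\<Sum>j=1..p. xv s j * dx s j f) + (\<Sum>j=1..q. xiv s j * dxi s j f)"

definition mn_cartan_odd :: "nat \<Rightarrow> nat \<Rightarrow> nat \<Rightarrow> superpoly \<Rightarrow> superpoly"
  where "mn_cartan_odd p q k f =
    (\<Sum>j=1..p. etav k j * deta k j f) + (\<Sum>j=1..q. yv k j * dy k j f)"

definition pq_root_even :: "nat \<Rightarrow> nat \<Rightarrow> nat \<Rightarrow> superpoly \<Rightarrow> superpoly"
  where "pq_root_even m n i f =
    (\<Sum>j=1..m. xv j (i - 1) * dx j i f) + (\<Sum>j=1..n. etav j (i - 1) * deta j i f)"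

definition pq_root_odd :: "nat \<Rightarrow> nat \<Rightarrow> nat \<Rightarrow> superpoly \<Rightarrow> superpoly"
  where "pq_root_odd m n l f =
    (\<Sum>j=1..m. xiv j (l - 1) * dxi j l f) + (\<Sum>j=1..n. yv j (l - 1) * dy j l f)"

definition pq_root_mixed :: "nat \<Rightarrow> nat \<Rightarrow> nat \<Rightarrow> superpoly \<Rightarrow> superpoly"
  where "pq_root_mixed p m n f =
    (\<Sum>j=1..m. xv j p * dxi j 1 f) + (\<Sum>j=1..n. etav j p * dy j 1 f)"

definition mn_root_even :: "nat \<Rightarrow> nat \<Rightarrow> nat \<Rightarrow> superpoly \<Rightarrow> superpoly"
  where "mn_root_even p q s f =
    (\<Sum>j=1..p. xv (s - 1) j * dx s j f) + (\<Sum>j=1..q. xiv (s - 1) j * dxi s j f)"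

definition mn_root_odd :: "nat \<Rightarrow> nat \<Rightarrow> nat \<Rightarrow> superpoly \<Rightarrow> superpoly"
  where "mn_root_odd p q k f =
    (\<Sum>j=1..p. etav (k - 1) j * deta k j f) + (\<Sum>j=1..q. yv (k - 1) j * dy k j f)"

definition mn_root_mixed :: "nat \<Rightarrow> nat \<Rightarrow> nat \<Rightarrow> superpoly \<Rightarrow> superpoly"
  where "mn_root_mixed m p q f =
    (\<Sum>j=1..p. xv m j * deta 1 j f) - (\<Sum>j=1..q. xiv m j * dy 1 j f)"

text \<open>
  A weight \<open>(\<mu>\<^sub>1, \<mu>\<^sub>2, \<dots>; \<nu>\<^sub>1, \<nu>\<^sub>2, \<dots>)\<close> is given by a pair of functions of the indices,
  of which only the values within the index bounds matter.
\<close>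

definition has_pq_weight ::
    "nat \<Rightarrow> nat \<Rightarrow> nat \<Rightarrow> nat \<Rightarrow> superpoly \<Rightarrow> (nat \<Rightarrow> complex) \<Rightarrow> (nat \<Rightarrow> complex) \<Rightarrow> bool"
  where "has_pq_weight p q m n v \<mu> \<nu> \<longleftrightarrow>
    (\<forall>i\<in>{1..p}. pq_cartan_even m n i v = scal (\<mu> i) * v) \<and>
    (\<forall>l\<in>{1..q}. pq_cartan_odd m n l v = scal (\<nu> l) * v)"

definition has_mn_weight ::
    "nat \<Rightarrow> nat \<Rightarrow> nat \<Rightarrow> nat \<Rightarrow> superpoly \<Rightarrow> (nat \<Rightarrow> complex) \<Rightarrow> (nat \<Rightarrow> complex) \<Rightarrow> bool"
  where "has_mn_weight p q m n v \<mu> \<nu> \<longleftrightarrow>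
    (\<forall>s\<in>{1..m}. mn_cartan_even p q s v = scal (\<mu> s) * v) \<and>
    (\<forall>k\<in>{1..n}. mn_cartan_odd p q k v = scal (\<nu> k) * v)"

text \<open>The mixed simple root exists only if both the even and the odd part are nonzero.\<close>

definition pq_annihilated :: "nat \<Rightarrow> nat \<Rightarrow> nat \<Rightarrow> nat \<Rightarrow> superpoly \<Rightarrow> bool"
  where "pq_annihilated p q m n v \<longleftrightarrow>
    (\<forall>i\<in>{1<..p}. pq_root_even m n i v = 0) \<and>
    (\<forall>l\<in>{1<..q}. pq_root_odd m n l v = 0) \<and>
    (1 \<le> p \<and> 1 \<le> q \<longrightarrow> pq_root_mixed p m n v = 0)"

definition mn_annihilated :: "nat \<Rightarrow> nat \<Rightarrow> nat \<Rightarrow> nat \<Rightarrow> superpoly \<Rightarrow> bool"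
  where "mn_annihilated p q m n v \<longleftrightarrow>
    (\<forall>s\<in>{1<..m}. mn_root_even p q s v = 0) \<and>
    (\<forall>k\<in>{1<..n}. mn_root_odd p q k v = 0) \<and>
    (1 \<le> m \<and> 1 \<le> n \<longrightarrow> mn_root_mixed m p q v = 0)"

definition highest_weight_vector ::
    "nat \<Rightarrow> nat \<Rightarrow> nat \<Rightarrow> nat \<Rightarrow> superpoly \<Rightarrow> bool"
  where "highest_weight_vector p q m n v \<longleftrightarrow>
    v \<in> superpolys p q m n \<and> v \<noteq> 0 \<and>
    (\<exists>\<mu> \<nu>. has_pq_weight p q m n v \<mu> \<nu>) \<and>
    (\<exists>\<mu> \<nu>. has_mn_weight p q m n v \<mu> \<nu>) \<and>
    pq_annihilated p q m n v \<and> mn_annihilated p q m n v"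


section \<open>Young diagrams\<close>

text \<open>A Young diagram is its set of boxes (row, column), both counted from 1.\<close>

definition young_diagram :: "(nat \<times> nat) set \<Rightarrow> bool"
  where "young_diagram L \<longleftrightarrow> finite L \<and> L \<subseteq> {1..} \<times> {1..} \<and>
    (\<forall>(i, j)\<in>L. {1..i} \<times> {1..j} \<subseteq> L)"

definition row_length :: "(nat \<times> nat) set \<Rightarrow> nat \<Rightarrow> nat"
  where "row_length L i = card {j. (i, j) \<in> L}"

definition rectangle :: "nat \<Rightarrow> nat \<Rightarrow> (nat \<times> nat) set"
  where "rectangle len wid = {1..len} \<times> {1..wid}"

definition pos_part :: "int \<Rightarrow> int"
  where "pos_part l = max l 0"

text \<open>The transposed diagram is the converse relation \<open>L\<inverse>\<close>.\<close>

definition corresponds_to ::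
    "nat \<Rightarrow> nat \<Rightarrow> nat \<Rightarrow> nat \<Rightarrow> superpoly \<Rightarrow> (nat \<times> nat) set \<Rightarrow> bool"
  where "corresponds_to p q m n v L \<longleftrightarrow>
    young_diagram L \<and>
    has_pq_weight p q m n v
      (\<lambda>i. of_nat (row_length L i))
      (\<lambda>l. of_int (pos_part (int (row_length (L\<inverse>) l) - int p))) \<and>
    has_mn_weight p q m n v
      (\<lambda>s. of_nat (row_length L s))
      (\<lambda>k. of_int (pos_part (int (row_length (L\<inverse>) k) - int m)))"


section \<open>The vectors \<open>\<Gamma>\<^sub>r\<close>\<close>

text \<open>Row-order determinant of the matrix with entry \<open>A i j\<close> in row \<open>i\<close> and column \<open>j\<close>.\<close>

definition rdet :: "nat \<Rightarrow> (nat \<Rightarrow> nat \<Rightarrow> 'a::ring_1) \<Rightarrow> 'a"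
  where "rdet k A =
    (\<Sum>\<sigma> | \<sigma> permutes {1..k}.
      of_int (sign \<sigma>) * prod_list (map (\<lambda>i. A i (\<sigma> i)) [1..<Suc k]))"

text \<open>A marked diagram is represented by its set of marked boxes (row, column).\<close>

definition marked_diagrams :: "nat \<Rightarrow> nat \<Rightarrow> (nat \<times> nat) set set"
  where "marked_diagrams m r =
    {D. D \<subseteq> {1..m} \<times> {1..r} \<and>
        (\<forall>i j j'. (j, i) \<in> D \<and> (j', i) \<in> D \<longrightarrow> j = j')}"

definition Y_mat :: "(nat \<times> nat) set \<Rightarrow> nat \<Rightarrow> nat \<Rightarrow> superpoly"
  where "Y_mat D i k =
    (if \<exists>j. (j, i) \<in> D then xiv (THE j. (j, i) \<in> D) k else yv i k)"

definition X_mat :: "(nat \<times> nat) set \<Rightarrow> nat \<Rightarrow> nat \<Rightarrow> nat \<Rightarrow> superpoly"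
  where "X_mat D i l k = (if (l, i) \<in> D then etav i k else xv l k)"

definition det_X :: "nat \<Rightarrow> nat \<Rightarrow> (nat \<times> nat) set \<Rightarrow> superpoly"
  where "det_X m r D = prod_list (map (\<lambda>i. rdet m (X_mat D i)) [1..<Suc r])"

definition Delta :: "nat \<Rightarrow> nat \<Rightarrow> (nat \<times> nat) set \<Rightarrow> superpoly"
  where "Delta m r D = det_X m r D * rdet r (Y_mat D)"

definition Gamma_vec :: "nat \<Rightarrow> nat \<Rightarrow> superpoly"
  where "Gamma_vec m r =
    (\<Sum>D\<in>marked_diagrams m r. (- 1) ^ (card D * (card D - 1) div 2) * Delta m r D)"

end

theory Submission
  imports Defs
begin

text \<open>
  The key is a closed formula for \<open>\<Gamma>\<^sub>r\<close>.  For \<open>a, k \<in> {1..r}\<close> let \<open>Z_a^k\<close> be the row-order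
  determinant of the matrix of size \<open>m + 1\<close> with rows \<open>(x_l^1, \<dots>, x_l^m, \<xi>_l^k)\<close> for
  \<open>l = 1, \<dots>, m\<close> and last row \<open>(\<eta>_a^1, \<dots>, \<eta>_a^m, y_a^k)\<close>.  Expanded along the last column,
  it is \<open>det X \<cdot> y_a^k\<close> plus the sum over \<open>j\<close> of \<open>det X' \<cdot> \<xi>_j^k\<close>, where \<open>X'\<close> is \<open>X\<close> with row \<open>j\<close>
  replaced by \<open>(\<eta>_a^1, \<dots>, \<eta>_a^m)\<close>; all signs are \<open>+\<close> (\<open>border_det_expand\<close>).  These summands
  correspond to the possible markings of column \<open>a\<close> of a diagram.  The sign in the definition of
  \<open>\<Gamma>\<^sub>r\<close> is the sign of interleaving the factors of \<open>det X_D\<close> with those of \<open>det Y_D\<close>, and therefore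
  \<open>\<Gamma>\<^sub>r = det (Z_a^k)\<close>, with even, hence commuting, entries (\<open>Gamma_vec_eq_rdet\<close>).

  All Cartan operators and root vectors are superderivations.  On a determinant, a superderivation
  that acts on one row or one column only replaces this row or column by its image, up to signs.
  So the claims reduce to what happens to the \<open>Z_a^k\<close>.

  The Cartan operators of the even indices fix every \<open>Z_a^k\<close>, so that their weight on the \<open>r\<close>-fold
  products in \<open>\<Gamma>\<^sub>r\<close> is \<open>r\<close>.  Those of the odd indices fix one row or column of \<open>(Z_a^k)\<close> and
  annihilate the other entries, which gives the weight \<open>1\<close>; beyond \<open>r\<close> they give \<open>0\<close>.  The root vectors
  of the even indices and the mixed ones annihilate every \<open>Z_a^k\<close>, because the image is a bordered
  determinant with two equal rows or columns.  Those of the odd indices shift \<open>k\<close> or \<open>a\<close>, and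
  produce two equal columns or rows in \<open>(Z_a^k)\<close>.  The one delicate case is the mixed root vector of
  \<open>gl(m|n)\<close>, whose minus sign makes up for the one of moving it past a \<open>\<xi>\<close>
  (\<open>mn_root_mixed_border_det\<close>).  Finally, \<open>\<Gamma>\<^sub>r\<close> takes the value \<open>1\<close> at a suitable point, so it is not \<open>0\<close>.
\<close>

section \<open>Parity and supercommutativity in the Grassmann algebra\<close>

text \<open>
  Parity \<open>True\<close> means odd.  This is a predicate and not a function because a sum of a nonzero even
  and a nonzero odd element has no parity, while \<open>0\<close> has both.
\<close>

definition has_parity :: "bool \<Rightarrow> ('o::linorder, 'r::comm_ring_1) grassmann \<Rightarrow> bool"
  where "has_parity e f \<longleftrightarrow> (\<forall>U. gcoeff f U \<noteq> 0 \<longrightarrow> odd (card U) = e)"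

lemma gcoeff_infinite: "infinite U \<Longrightarrow> gcoeff f U = 0"
  using gcoeff[of f] by blast

lemma has_parity_0 [simp]: "has_parity e 0"
  by (simp add: has_parity_def zero_grassmann.rep_eq)

lemma has_parity_1 [simp]: "has_parity False 1"
  by (simp add: has_parity_def one_grassmann.rep_eq)

lemma has_parity_gconst [simp]: "has_parity False (gconst c)"
  by (simp add: has_parity_def gconst.rep_eq)

lemma has_parity_godd [simp]: "has_parity True (godd v)"
  by (simp add: has_parity_def godd.rep_eq)

lemma has_parity_add: "has_parity e f \<Longrightarrow> has_parity e g \<Longrightarrow> has_parity e (f + g)"
  unfolding has_parity_def plus_grassmann.rep_eq by (metis add.right_neutral)

lemma has_parity_uminus [simp]: "has_parity e (- f) = has_parity e f"
  by (simp add: has_parity_def uminus_grassmann.rep_eq)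

lemma has_parity_sum: "(\<And>i. i \<in> I \<Longrightarrow> has_parity e (f i)) \<Longrightarrow> has_parity e (sum f I)"
  by (induction I rule: infinite_finite_induct) (auto intro: has_parity_add)

lemma has_parity_mult:
  assumes "has_parity e f" "has_parity e' g"
  shows "has_parity (e \<noteq> e') (f * g)"
  unfolding has_parity_def
proof (intro allI impI)
  fix U assume nz: "gcoeff (f * g) U \<noteq> 0"
  then have fin: "finite U" using gcoeff_infinite by blast
  from nz obtain S where S: "S \<subseteq> U" "gsign S (U - S) * gcoeff f S * gcoeff g (U - S) \<noteq> 0"
    unfolding times_grassmann.rep_eq gmul_def by (metis (no_types, lifting) Pow_iff sum.neutral)
  then have "odd (card S) = e" "odd (card (U - S)) = e'"
    using assms unfolding has_parity_def by (metis mult_zero_left mult_zero_right)+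
  moreover have "card U = card S + card (U - S)"
    using S(1) fin by (metis card_Diff_subset card_mono finite_subset le_add_diff_inverse)
  ultimately show "odd (card U) = (e \<noteq> e')" by auto
qed

lemma gsign_swap:
  assumes "finite S" "finite T" "S \<inter> T = {}"
  shows "gsign S T = ((- 1) ^ (card S * card T) * gsign T S :: 'r::ring_1)"
proof -
  let ?A = "{(s, t). s \<in> S \<and> t \<in> T \<and> t < s}" and ?B = "{(t, s). t \<in> T \<and> s \<in> S \<and> s < t}"
  have "card S * card T = card (S \<times> T)" by (simp add: card_cartesian_product)
  also have "S \<times> T = ?A \<union> prod.swap ` ?B"
    using assms(3) by (auto simp: image_iff)
  also have "card \<dots> = card ?A + card (prod.swap ` ?B)"
    using assms by (intro card_Un_disjoint)
      (auto intro: finite_subset[of _ "S \<times> T"] finite_subset[of _ "T \<times> S"])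
  also have "card (prod.swap ` ?B) = card ?B"
    by (intro card_image) (auto simp: inj_on_def)
  finally have "card S * card T = card ?A + card ?B" .
  then show ?thesis
    by (simp add: gsign_def minus_one_power_iff)
qed

lemma gsign_square [simp]: "gsign S T * gsign S T = (1 :: 'r::ring_1)"
  by (simp add: gsign_def flip: power_add mult_2)

lemma gsign_square_left [simp]: "gsign S T * (gsign S T * x) = (x :: 'r::ring_1)"
  by (simp flip: mult.assoc)

text \<open>
  Splitting an index set as \<open>S \<union> (U - S)\<close> and exchanging the two parts matches the terms of
  \<open>f * g\<close> with those of \<open>g * f\<close>; by \<open>gsign_swap\<close> their signs differ by
  \<open>(- 1) ^ (card S * card (U - S))\<close>, which depends only on the parities of \<open>f\<close> and \<open>g\<close>.
\<close>

lemma supercommute: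
  assumes "has_parity e f" "has_parity e' g"
  shows "f * g = (if e \<and> e' then - (g * f) else g * f)"
proof -
  have "gcoeff (f * g) U = (if e \<and> e' then - 1 else 1) * gcoeff (g * f) U" for U
  proof (cases "finite U")
    case True
    have "gcoeff (f * g) U = (\<Sum>S\<in>Pow U. gsign (U - S) S * gcoeff f (U - S) * gcoeff g S)"
      unfolding times_grassmann.rep_eq gmul_def
      by (rule sum.reindex_bij_witness[of _ "\<lambda>S. U - S" "\<lambda>S. U - S"])
        (auto simp: double_diff)
    also have "\<dots> = (\<Sum>S\<in>Pow U. (if e \<and> e' then - 1 else 1) *
        (gsign S (U - S) * gcoeff g S * gcoeff f (U - S)))"
    proof (intro sum.cong refl)
      fix S assume "S \<in> Pow U"
      then have fin: "finite S" "finite (U - S)" using True by (auto intro: finite_subset)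
      have disj: "(U - S) \<inter> S = {}" by blast
      have "gsign (U - S) S = (if e \<and> e' then - 1 else 1) * (gsign S (U - S) :: 'b)"
        if "gcoeff f (U - S) \<noteq> 0" "gcoeff g S \<noteq> 0"
        using assms that gsign_swap[OF fin(2,1) disj, where 'r = 'b]
        unfolding has_parity_def by (auto simp: minus_one_power_iff)
      then show "gsign (U - S) S * gcoeff f (U - S) * gcoeff g S = (if e \<and> e' then - 1 else 1) *
        (gsign S (U - S) * gcoeff g S * gcoeff f (U - S))"
        by (cases "gcoeff f (U - S) = 0 \<or> gcoeff g S = 0") (auto simp: mult_ac)
    qed
    finally show ?thesis
      by (simp add: times_grassmann.rep_eq gmul_def sum_distrib_left)
  qed (simp add: gcoeff_infinite)
  then show ?thesis
    by (auto simp: gcoeff_inject[symmetric] fun_eq_iff uminus_grassmann.rep_eq)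
qed

corollary even_commute: "has_parity False f \<Longrightarrow> has_parity e g \<Longrightarrow> f * g = g * f"
  using supercommute[of False f e g] by simp

corollary odd_anticommute: "has_parity True f \<Longrightarrow> has_parity True g \<Longrightarrow> f * g = - (g * f)"
  using supercommute[of True f True g] by simp

section \<open>Superderivations\<close>

text \<open>
  \<open>d\<close> is the parity of the operator.  The Leibniz rule is required for homogeneous left factors
  only, where the sign makes sense; both sides being additive, this determines \<open>D\<close> on all products.
\<close>

definition superderivation ::
    "bool \<Rightarrow> (('o::linorder, 'r::comm_ring_1) grassmann \<Rightarrow> ('o, 'r) grassmann) \<Rightarrow> bool"
  where "superderivation d D \<longleftrightarrow> (\<forall>f g. D (f + g) = D f + D g) \<and>
    (\<forall>e f g. has_parity e f \<longrightarrow>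
      D (f * g) = D f * g + (if d \<and> e then - (f * D g) else f * D g))"

lemma superderivation_leibniz:
  "superderivation d D \<Longrightarrow> has_parity e f \<Longrightarrow>
    D (f * g) = D f * g + (if d \<and> e then - (f * D g) else f * D g)"
  by (simp add: superderivation_def)

lemma superderivation_add: "superderivation d D \<Longrightarrow> D (f + g) = D f + D g"
  by (simp add: superderivation_def)

lemma superderivation_0: "superderivation d D \<Longrightarrow> D 0 = 0"
  using superderivation_add[of d D 0 0] by simp

lemma superderivation_uminus: "superderivation d D \<Longrightarrow> D (- f) = - D f"
  using superderivation_add[of d D f "- f"] superderivation_0[of d D]
  by (simp add: eq_neg_iff_add_eq_0 add.commute)

lemma superderivation_sum: "superderivation d D \<Longrightarrow> D (sum f I) = (\<Sum>i\<in>I. D (f i))"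
  by (induction I rule: infinite_finite_induct) (auto simp: superderivation_0 superderivation_add)

lemma superderivation_1: "superderivation d D \<Longrightarrow> D 1 = 0"
  using superderivation_leibniz[of d D False 1 1] by simp

lemma superderivation_sign:
  "superderivation d D \<Longrightarrow> D (of_int (sign \<sigma>) * f) = of_int (sign \<sigma>) * D f"
  by (simp add: sign_def superderivation_uminus)

text \<open>
  Polynomial vector fields, such as the root vectors, are sums of products of a generator with a
  partial derivative; so this lemma makes them superderivations once the partial derivatives are.
\<close>

lemma superderivation_mult_left:
  assumes "has_parity e c" "superderivation d D"
  shows "superderivation (d \<noteq> e) (\<lambda>f. c * D f)"
  unfolding superderivation_def
proof (intro conjI allI impI)
  show "c * D (f + g) = c * D f + c * D g" for f g
    using assms(2) by (simp add: superderivation_add distrib_left)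
  show "c * D (f * g) = c * D f * g +
      (if (d \<noteq> e) \<and> e' then - (f * (c * D g)) else f * (c * D g))"
    if f: "has_parity e' f" for e' f g
  proof -
    have "f * (c * D g) = (if e \<and> e' then - (c * (f * D g)) else c * (f * D g))"
      using supercommute[OF f assms(1)] by (auto simp flip: mult.assoc)
    then show ?thesis
      by (auto simp: superderivation_leibniz[OF assms(2) f] algebra_simps)
  qed
qed

lemma superderivation_plus:
  "superderivation d D \<Longrightarrow> superderivation d E \<Longrightarrow> superderivation d (\<lambda>f. D f + E f)"
  by (auto simp: superderivation_def algebra_simps)

lemma superderivation_minus:
  "superderivation d D \<Longrightarrow> superderivation d E \<Longrightarrow> superderivation d (\<lambda>f. D f - E f)"
  by (auto simp: superderivation_def algebra_simps)

lemma superderivation_zero: "superderivation d (\<lambda>f. 0)"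
  by (simp add: superderivation_def)

lemma superderivation_Sum:
  "(\<And>i. i \<in> I \<Longrightarrow> superderivation d (D i)) \<Longrightarrow> superderivation d (\<lambda>f. \<Sum>i\<in>I. D i f)"
  by (induction I rule: infinite_finite_induct)
    (auto intro: superderivation_plus superderivation_zero)

text \<open>
  The signs \<open>gsign\<close> in the product are \<open>\<plusminus>1\<close>, hence commute with every additive map; so the Leibniz
  rule passes from the coefficient ring to the Grassmann algebra term by term.
\<close>

lemma superderivation_gmap:
  fixes d :: "'r::comm_ring_1 \<Rightarrow> 'r"
  assumes add: "\<And>a b. d (a + b) = d a + d b" and mult: "\<And>a b. d (a * b) = d a * b + a * d b"
  shows "superderivation False (gmap d :: ('o::linorder, 'r::comm_ring_1) grassmann \<Rightarrow> _)"
proof -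
  have d0: "d 0 = 0" using add[of 0 0] by simp
  have dneg: "d (- a) = - d a" for a
    using add[of a "- a"] d0 by (simp add: eq_neg_iff_add_eq_0 add.commute)
  have dsum: "d (sum f I) = (\<Sum>i\<in>I. d (f i))" for f and I :: "'o set set"
    by (induction I rule: infinite_finite_induct) (auto simp: d0 add)
  have dsign: "d (gsign S T * a) = gsign S T * d a" for S T :: "'o set" and a
    by (simp add: gsign_def minus_one_power_iff dneg)
  have dmult: "d (gsign S T * a * b) = gsign S T * d a * b + gsign S T * a * d b"
    for S T :: "'o set" and a b
    by (subst mult.assoc, subst dsign) (simp add: mult distrib_left mult.assoc)
  have gmap: "gcoeff (gmap d f) U = d (gcoeff f U)" for f U
    by (simp add: gmap.rep_eq d0)
  have "gmap d (f + g) = gmap d f + gmap d g" for f g :: "('o, 'r) grassmann"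
    by (simp add: gcoeff_inject[symmetric] fun_eq_iff plus_grassmann.rep_eq gmap add)
  moreover have "gmap d (f * g) = gmap d f * g + f * gmap d g" for f g :: "('o, 'r) grassmann"
    by (simp add: gcoeff_inject[symmetric] fun_eq_iff plus_grassmann.rep_eq gmap
        times_grassmann.rep_eq gmul_def dsum dmult sum.distrib)
  ultimately show ?thesis by (simp add: superderivation_def)
qed

lemma gsign_insert_left:
  assumes "finite S" "finite T" "v \<notin> S"
  shows "gsign (insert v S) T = (gsign {v} T * gsign S T :: 'r::ring_1)"
  using gsign_Un_left[of "{v}" S T] assms by simp

lemma gsign_insert_right:
  assumes "finite S" "finite T" "v \<notin> S"
  shows "gsign T (insert v S) = (gsign T {v} * gsign T S :: 'r::ring_1)"
  using gsign_Un_right[of "{v}" S T] assms by simp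

lemma sum_Pow_insert:
  assumes "finite U" "v \<notin> U"
  shows "(\<Sum>S\<in>Pow (insert v U). h S) = (\<Sum>S\<in>Pow U. h S) + (\<Sum>S\<in>Pow U. h (insert v S))"
proof -
  have "inj_on (insert v) (Pow U)"
    using assms(2) by (intro inj_onI) (metis Pow_iff insert_ident subsetD)
  then show ?thesis
    using assms by (subst Pow_insert, subst sum.union_disjoint) (auto simp: sum.reindex)
qed

text \<open>
  Compare the coefficients at an index set \<open>U\<close>.  If \<open>v \<notin> U\<close>, the terms of \<open>f * g\<close> at
  \<open>insert v U\<close> split according to whether \<open>f\<close> or \<open>g\<close> contributes \<open>v\<close>, and the two groups
  are the two terms of the Leibniz rule.  If \<open>v \<in> U\<close>, the left side is \<open>0\<close> and the two terms on
  the right cancel, because both come from pairs of monomials that each contain \<open>v\<close>.  Moving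
  \<open>v\<close> past a monomial of \<open>f\<close> costs the sign of the parity of that monomial.
\<close>

lemma superderivation_godd_deriv: "superderivation True (godd_deriv v)"
  unfolding superderivation_def
proof (intro conjI allI impI)
  show "godd_deriv v (f + g) = godd_deriv v f + godd_deriv v g" for f g
    by (simp add: gcoeff_inject[symmetric] fun_eq_iff plus_grassmann.rep_eq godd_deriv.rep_eq
        distrib_left)
  fix e and f g :: "('a, 'b) grassmann"
  assume f: "has_parity e f"
  let ?F = "gcoeff f" and ?G = "gcoeff g"
  define s :: 'b where "s = (if e then - 1 else 1)"
  have sgn: "gsign S {v} * ?F S = s * (gsign {v} S * ?F S)" if "finite S" "v \<notin> S" for S
  proof (cases "?F S = 0")
    case False
    then have "odd (card S) = e" using f by (simp add: has_parity_def)
    then show ?thesis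
      using gsign_swap[of S "{v}", where 'r = 'b] that by (auto simp: s_def minus_one_power_iff)
  qed simp
  have sgn': "gsign S {v} * ?F (insert v S) = - s * (gsign {v} S * ?F (insert v S))"
    if "finite S" "v \<notin> S" for S
  proof (cases "?F (insert v S) = 0")
    case False
    then have "odd (card (insert v S)) = e" using f by (simp add: has_parity_def)
    then show ?thesis
      using gsign_swap[of S "{v}", where 'r = 'b] that by (auto simp: s_def minus_one_power_iff)
  qed simp
  have "gcoeff (godd_deriv v (f * g)) U =
      gcoeff (godd_deriv v f * g) U + s * gcoeff (f * godd_deriv v g) U" for U
  proof (cases "finite U")
    case fin: True
    show ?thesis
    proof (cases "v \<in> U")
      case False
      have "gcoeff (godd_deriv v (f * g)) U = gsign {v} U *
          ((\<Sum>S\<in>Pow U. gsign S (insert v U - S) * ?F S * ?G (insert v U - S))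
          + (\<Sum>S\<in>Pow U. gsign (insert v S) (insert v U - insert v S) * ?F (insert v S)
              * ?G (insert v U - insert v S)))"
        using False
        by (simp add: godd_deriv.rep_eq times_grassmann.rep_eq gmul_def sum_Pow_insert[OF fin False])
      also have "\<dots> = (\<Sum>S\<in>Pow U. s * (gsign S (U - S) * ?F S *
              (gsign {v} (U - S) * ?G (insert v (U - S)))))
          + (\<Sum>S\<in>Pow U. gsign S (U - S) * (gsign {v} S * ?F (insert v S)) * ?G (U - S))"
        unfolding distrib_left sum_distrib_left
      proof (intro arg_cong2[of _ _ _ _ "(+)"] sum.cong refl)
        fix S assume "S \<in> Pow U"
        then have S: "S \<subseteq> U" "finite S" "finite (U - S)" "v \<notin> S" "v \<notin> U - S"
          using fin False by (auto intro: finite_subset)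
        have U: "gsign {v} U = (gsign {v} S * gsign {v} (U - S) :: 'b)"
          using gsign_Un_right[of S "U - S" "{v}", where 'r = 'b] S by (simp add: Un_absorb1)
        have eq: "insert v U - S = insert v (U - S)" "insert v U - insert v S = U - S"
          using S by auto
        show "gsign {v} U * (gsign S (insert v U - S) * ?F S * ?G (insert v U - S))
          = s * (gsign S (U - S) * ?F S * (gsign {v} (U - S) * ?G (insert v (U - S))))"
        proof -
          have "gsign {v} U * (gsign S (insert v U - S) * ?F S * ?G (insert v U - S))
            = (gsign S {v} * ?F S) *
              (gsign {v} S * gsign {v} (U - S) * gsign S (U - S) * ?G (insert v (U - S)))"
            by (simp add: eq U gsign_insert_right[OF S(3,2,5)] mult_ac)
          also have "\<dots> = s * (gsign S (U - S) * ?F S * (gsign {v} (U - S) * ?G (insert v (U - S))))"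
            by (subst sgn[OF S(2,4)]) (simp add: mult_ac)
          finally show ?thesis .
        qed
        show "gsign {v} U * (gsign (insert v S) (insert v U - insert v S) * ?F (insert v S)
              * ?G (insert v U - insert v S))
          = gsign S (U - S) * (gsign {v} S * ?F (insert v S)) * ?G (U - S)"
          by (simp add: eq U gsign_insert_left[OF S(2,3,4)] mult_ac)
      qed
      also have "\<dots> = s * gcoeff (f * godd_deriv v g) U + gcoeff (godd_deriv v f * g) U"
        using False
        by (auto simp: godd_deriv.rep_eq times_grassmann.rep_eq gmul_def sum_distrib_left
            intro!: arg_cong2[of _ _ _ _ "(+)"] sum.cong)
      finally show ?thesis by (simp add: add.commute)
    next
      case True
      define V where "V = U - {v}"
      have V: "U = insert v V" "v \<notin> V" "finite V" using True fin by (auto simp: V_def)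
      have diff: "insert v V - S = insert v (V - S)" "insert v V - insert v S = V - S"
        if "S \<subseteq> V" for S using that V by auto
      have vn: "v \<notin> S" if "S \<subseteq> V" for S using that V by auto
      have "gcoeff (godd_deriv v f * g) U =
          (\<Sum>S\<in>Pow V. gsign S (insert v (V - S)) * (gsign {v} S * ?F (insert v S))
            * ?G (insert v (V - S)))"
        by (simp add: times_grassmann.rep_eq gmul_def V(1) sum_Pow_insert[OF V(3,2)]
            godd_deriv.rep_eq diff vn cong: sum.cong_simp)
      moreover have "gcoeff (f * godd_deriv v g) U =
          (\<Sum>S\<in>Pow V. gsign (insert v S) (V - S) * ?F (insert v S) *
            (gsign {v} (V - S) * ?G (insert v (V - S))))"
        using V(2)
        by (simp add: times_grassmann.rep_eq gmul_def V(1) sum_Pow_insert[OF V(3,2)]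
            godd_deriv.rep_eq diff vn cong: sum.cong_simp)
      moreover have "gsign S (insert v (V - S)) * (gsign {v} S * ?F (insert v S))
            * ?G (insert v (V - S)) +
          s * (gsign (insert v S) (V - S) * ?F (insert v S) *
            (gsign {v} (V - S) * ?G (insert v (V - S)))) = 0" if "S \<in> Pow V" for S
      proof -
        have S: "finite S" "finite (V - S)" "v \<notin> S" "v \<notin> V - S"
          using that V by (auto intro: finite_subset)
        have "gsign S (insert v (V - S)) * (gsign {v} S * ?F (insert v S)) * ?G (insert v (V - S))
          = (gsign S {v} * ?F (insert v S)) * (gsign S (V - S) * gsign {v} S * ?G (insert v (V - S)))"
          by (simp add: gsign_insert_right[OF S(2,1,4)] mult_ac)
        also have "\<dots> = - s * (?F (insert v S) * (gsign S (V - S) * ?G (insert v (V - S))))"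
          by (subst sgn'[OF S(1,3)]) (simp add: mult_ac)
        finally show ?thesis by (simp add: gsign_insert_left[OF S(1,2,3)] mult_ac)
      qed
      ultimately show ?thesis
        using True by (simp add: godd_deriv.rep_eq sum_distrib_left flip: sum.distrib)
    qed
  qed (simp add: gcoeff_infinite)
  then show "godd_deriv v (f * g) = godd_deriv v f * g +
      (if True \<and> e then - (f * godd_deriv v g) else f * godd_deriv v g)"
    by (auto simp: gcoeff_inject[symmetric] fun_eq_iff plus_grassmann.rep_eq s_def
        uminus_grassmann.rep_eq)
qed

section \<open>Derivatives and evaluation of the even variables\<close>

text \<open>
  Every polynomial is a sum of terms, so that an identity between additive maps need only be
  checked on single terms.
\<close>

lemma poly_mapping_induct_add [case_names zero single add]:
  assumes "P 0" "\<And>k c. P (Poly_Mapping.single k c)" "\<And>f g. P f \<Longrightarrow> P g \<Longrightarrow> P (f + g)"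
  shows "P (f :: 'a \<Rightarrow>\<^sub>0 'b::comm_monoid_add)"
proof -
  have "f = (\<Sum>k\<in>Poly_Mapping.keys f. Poly_Mapping.single k (Poly_Mapping.lookup f k))"
    by (rule poly_mapping_eqI) (auto simp: lookup_sum lookup_single when_def in_keys_iff)
  moreover have "P (\<Sum>k\<in>K. Poly_Mapping.single k (Poly_Mapping.lookup f k))" for K
    by (induction K rule: infinite_finite_induct) (auto intro: assms)
  ultimately show ?thesis by metis
qed

lemma evpoly_deriv_add: "evpoly_deriv v (f + g) = evpoly_deriv v f + evpoly_deriv v g"
  unfolding evpoly_deriv_def
  by (intro setsum_keys_plus_distrib) (simp_all add: distrib_left single_add)

lemma evpoly_deriv_single:
  "evpoly_deriv v (Poly_Mapping.single a c) =
    Poly_Mapping.single (a - Poly_Mapping.single v 1) (of_nat (Poly_Mapping.lookup a v) * c)"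
  by (cases "c = 0") (simp_all add: evpoly_deriv_def)

lemma evpoly_deriv_0 [simp]: "evpoly_deriv v 0 = 0"
  by (simp add: evpoly_deriv_def)

lemma evpoly_deriv_mult: "evpoly_deriv v (f * g) = evpoly_deriv v f * g + f * evpoly_deriv v g"
proof (induction f rule: poly_mapping_induct_add)
  case (single a c)
  show ?case
  proof (induction g rule: poly_mapping_induct_add)
    case (single b d)
    let ?v = "Poly_Mapping.single v (1::nat)"
    have "a + b - ?v = a - ?v + b" if "Poly_Mapping.lookup a v \<noteq> 0"
      using that by (intro poly_mapping_eqI) (auto simp: lookup_add lookup_minus lookup_single when_def)
    then have "Poly_Mapping.single (a + b - ?v) (of_nat (Poly_Mapping.lookup a v) * (c * d)) =
        Poly_Mapping.single (a - ?v + b) (of_nat (Poly_Mapping.lookup a v) * (c * d))"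
      by (cases "Poly_Mapping.lookup a v = 0") simp_all
    moreover have "a + b - ?v = a + (b - ?v)" if "Poly_Mapping.lookup b v \<noteq> 0"
      using that by (intro poly_mapping_eqI) (auto simp: lookup_add lookup_minus lookup_single when_def)
    then have "Poly_Mapping.single (a + b - ?v) (of_nat (Poly_Mapping.lookup b v) * (c * d)) =
        Poly_Mapping.single (a + (b - ?v)) (of_nat (Poly_Mapping.lookup b v) * (c * d))"
      by (cases "Poly_Mapping.lookup b v = 0") simp_all
    ultimately show ?case
      by (simp add: mult_single evpoly_deriv_single lookup_add distrib_left single_add mult_ac
          add_ac)
  qed (simp_all add: evpoly_deriv_add distrib_left distrib_right)
qed (simp_all add: evpoly_deriv_add distrib_left distrib_right)

text \<open>
  Evaluation at the point where the variables in \<open>V\<close> are \<open>1\<close> and all others are \<open>0\<close>: a monomial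
  takes the value \<open>1\<close> or \<open>0\<close> according to whether all its variables lie in \<open>V\<close>.
\<close>

definition ev_at :: "evar set \<Rightarrow> evpoly \<Rightarrow> complex"
  where "ev_at V f =
    (\<Sum>a\<in>Poly_Mapping.keys f. if Poly_Mapping.keys a \<subseteq> V then Poly_Mapping.lookup f a else 0)"

lemma ev_at_add: "ev_at V (f + g) = ev_at V f + ev_at V g"
  unfolding ev_at_def by (intro setsum_keys_plus_distrib) simp_all

lemma ev_at_0 [simp]: "ev_at V 0 = 0"
  by (simp add: ev_at_def)

lemma ev_at_single: "ev_at V (Poly_Mapping.single a c) = (if Poly_Mapping.keys a \<subseteq> V then c else 0)"
  by (cases "c = 0") (simp_all add: ev_at_def)

lemma ev_at_mult: "ev_at V (f * g) = ev_at V f * ev_at V g"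
proof (induction f rule: poly_mapping_induct_add)
  case (single a c)
  show ?case
  proof (induction g rule: poly_mapping_induct_add)
    case (single b d)
    have "Poly_Mapping.keys (a + b) = Poly_Mapping.keys a \<union> Poly_Mapping.keys b"
      by (auto simp: in_keys_iff lookup_add)
    then show ?case by (simp add: mult_single ev_at_single)
  qed (simp_all add: ev_at_add distrib_left distrib_right)
qed (simp_all add: ev_at_add distrib_left distrib_right)

text \<open>
  Setting all odd variables to \<open>0\<close> and then evaluating the even ones is a ring homomorphism to the
  complex numbers.  It detects that an element is nonzero.
\<close>

definition body_at :: "evar set \<Rightarrow> superpoly \<Rightarrow> complex"
  where "body_at V f = ev_at V (gcoeff f {})"

lemma body_at_add: "body_at V (f + g) = body_at V f + body_at V g"
  by (simp add: body_at_def plus_grassmann.rep_eq ev_at_add)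

lemma body_at_mult: "body_at V (f * g) = body_at V f * body_at V g"
  by (simp add: body_at_def times_grassmann.rep_eq gmul_def ev_at_mult)

lemma body_at_1 [simp]: "body_at V 1 = 1"
  by (simp add: body_at_def one_grassmann.rep_eq ev_at_single flip: single_one)

lemma body_at_0 [simp]: "body_at V 0 = 0"
  by (simp add: body_at_def zero_grassmann.rep_eq)

lemma body_at_evgen: "body_at V (evgen v) = (if v \<in> V then 1 else 0)"
  by (simp add: body_at_def evgen_def gconst.rep_eq ev_at_single)

lemma body_at_godd: "body_at V (godd v) = 0"
  by (simp add: body_at_def godd.rep_eq)

lemma evpoly_double_zero:
  assumes "c = - c" shows "(c :: evpoly) = 0"
proof (rule poly_mapping_eqI)
  fix k
  have "Poly_Mapping.lookup c k = - Poly_Mapping.lookup c k"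
    using assms by (metis lookup_uminus)
  then show "Poly_Mapping.lookup c k = Poly_Mapping.lookup 0 k" by simp
qed

text \<open>
  Determinants with a repeated row or column are shown to vanish by reindexing over a
  transposition, which only yields that they equal their own negatives.
\<close>

lemma superpoly_double_zero:
  assumes "f = - f" shows "(f :: superpoly) = 0"
proof -
  have "gcoeff f U = 0" for U
    using assms evpoly_double_zero by (metis uminus_grassmann.rep_eq)
  then show ?thesis by (simp add: gcoeff_inject[symmetric] fun_eq_iff zero_grassmann.rep_eq)
qed

section \<open>The action of the partial derivatives on the generators\<close>

lemma superderivation_even_deriv:
  "superderivation False (dx l i)" "superderivation False (dy k j)"
  unfolding dx_def dy_def
  by (intro superderivation_gmap evpoly_deriv_add evpoly_deriv_mult)+

lemma superderivation_odd_deriv: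
  "superderivation True (dxi l j)" "superderivation True (deta k i)"
  unfolding dxi_def deta_def by (rule superderivation_godd_deriv)+

lemma has_parity_generators [simp]:
  "has_parity False (xv l i)" "has_parity False (yv k j)"
  "has_parity True (xiv l j)" "has_parity True (etav k i)"
  by (simp_all add: xv_def yv_def xiv_def etav_def evgen_def)

lemma gmap_evpoly_deriv_evgen: "gmap (evpoly_deriv v) (evgen w) = (if v = w then 1 else 0)"
proof -
  have "evpoly_deriv v (Poly_Mapping.single (Poly_Mapping.single w 1) 1) = (if v = w then 1 else 0)"
    by (simp add: evpoly_deriv_single lookup_single when_def)
  then show ?thesis
    by (auto simp: gcoeff_inject[symmetric] fun_eq_iff gmap.rep_eq evgen_def gconst.rep_eq
        one_grassmann.rep_eq zero_grassmann.rep_eq)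
qed

lemma gmap_evpoly_deriv_godd: "gmap (evpoly_deriv v) (godd w) = 0"
proof -
  have "evpoly_deriv v 1 = 0"
    by (simp add: evpoly_deriv_single flip: single_one)
  then show ?thesis
    by (auto simp: gcoeff_inject[symmetric] fun_eq_iff gmap.rep_eq godd.rep_eq
        zero_grassmann.rep_eq)
qed

lemma godd_deriv_evgen: "godd_deriv v (evgen w) = 0"
  by (auto simp: gcoeff_inject[symmetric] fun_eq_iff godd_deriv.rep_eq evgen_def gconst.rep_eq
      zero_grassmann.rep_eq)

lemma godd_deriv_godd: "godd_deriv v (godd w) = (if v = w then 1 else 0)"
  by (auto simp: gcoeff_inject[symmetric] fun_eq_iff godd_deriv.rep_eq godd.rep_eq
      zero_grassmann.rep_eq one_grassmann.rep_eq)

lemma deriv_generators: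
  "dx l i (xv a b) = (if a = l \<and> b = i then 1 else 0)"
  "dx l i (yv a b) = 0" "dx l i (xiv a b) = 0" "dx l i (etav a b) = 0"
  "dy l i (yv a b) = (if a = l \<and> b = i then 1 else 0)"
  "dy l i (xv a b) = 0" "dy l i (xiv a b) = 0" "dy l i (etav a b) = 0"
  "dxi l i (xiv a b) = (if a = l \<and> b = i then 1 else 0)"
  "dxi l i (xv a b) = 0" "dxi l i (yv a b) = 0" "dxi l i (etav a b) = 0"
  "deta l i (etav a b) = (if a = l \<and> b = i then 1 else 0)"
  "deta l i (xv a b) = 0" "deta l i (yv a b) = 0" "deta l i (xiv a b) = 0"
  by (auto simp: dx_def dy_def dxi_def deta_def xv_def yv_def xiv_def etav_def
      gmap_evpoly_deriv_evgen gmap_evpoly_deriv_godd godd_deriv_evgen godd_deriv_godd)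

lemma scal_of_nat: "scal (of_nat n) = of_nat n"
proof (induction n)
  case 0
  show ?case by (auto simp: scal_def gcoeff_inject[symmetric] fun_eq_iff gconst.rep_eq
        zero_grassmann.rep_eq)
next
  case (Suc n)
  have "scal (1 + of_nat n) = 1 + scal (of_nat n)"
    by (auto simp: scal_def gcoeff_inject[symmetric] fun_eq_iff gconst.rep_eq
        one_grassmann.rep_eq plus_grassmann.rep_eq single_add)
  then show ?case by (simp add: Suc)
qed

section \<open>The subalgebra in the variables within the index bounds\<close>

lemma keys_superpolys:
  "f \<in> superpolys p q m n \<Longrightarrow> a \<in> Poly_Mapping.keys (gcoeff f U) \<Longrightarrow>
    Poly_Mapping.keys a \<subseteq> evars p q m n"
  by (cases "gcoeff f U = 0") (auto simp: superpolys_def)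

lemma keys_uminus_eq: "Poly_Mapping.keys (- f) = Poly_Mapping.keys (f :: evpoly)"
  by (auto simp: in_keys_iff)

lemma superpolys_0: "0 \<in> superpolys p q m n"
  by (simp add: superpolys_def zero_grassmann.rep_eq)

lemma superpolys_1: "1 \<in> superpolys p q m n"
  by (simp add: superpolys_def one_grassmann.rep_eq)

lemma superpolys_uminus: "f \<in> superpolys p q m n \<Longrightarrow> - f \<in> superpolys p q m n"
  by (simp add: superpolys_def uminus_grassmann.rep_eq keys_uminus_eq)

lemma superpolys_add:
  assumes "f \<in> superpolys p q m n" "g \<in> superpolys p q m n"
  shows "f + g \<in> superpolys p q m n"
proof -
  have "U \<subseteq> ovars p q m n \<and>
      (\<forall>a\<in>Poly_Mapping.keys (gcoeff f U + gcoeff g U). Poly_Mapping.keys a \<subseteq> evars p q m n)"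
    if nz: "gcoeff f U + gcoeff g U \<noteq> 0" for U
  proof (intro conjI ballI)
    from nz have "gcoeff f U \<noteq> 0 \<or> gcoeff g U \<noteq> 0" by auto
    then show "U \<subseteq> ovars p q m n" using assms unfolding superpolys_def by blast
    fix a assume "a \<in> Poly_Mapping.keys (gcoeff f U + gcoeff g U)"
    then have "a \<in> Poly_Mapping.keys (gcoeff f U) \<or> a \<in> Poly_Mapping.keys (gcoeff g U)"
      using subsetD[OF Poly_Mapping.keys_add] by (simp only: Un_iff)
    then show "Poly_Mapping.keys a \<subseteq> evars p q m n"
      using keys_superpolys[OF assms(1)] keys_superpolys[OF assms(2)] by (elim disjE)
  qed
  then show ?thesis by (simp add: superpolys_def plus_grassmann.rep_eq)
qed

lemma superpolys_sum: "(\<And>i. i \<in> I \<Longrightarrow> f i \<in> superpolys p q m n) \<Longrightarrow> sum f I \<in> superpolys p q m n"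
  by (induction I rule: infinite_finite_induct) (auto intro: superpolys_add superpolys_0)

lemma superpolys_mult:
  assumes "f \<in> superpolys p q m n" "g \<in> superpolys p q m n"
  shows "f * g \<in> superpolys p q m n"
proof -
  have "U \<subseteq> ovars p q m n \<and>
      (\<forall>a\<in>Poly_Mapping.keys (gmul (gcoeff f) (gcoeff g) U). Poly_Mapping.keys a \<subseteq> evars p q m n)"
    if nz: "gmul (gcoeff f) (gcoeff g) U \<noteq> 0" for U
  proof (intro conjI ballI)
    show "U \<subseteq> ovars p q m n"
      using gmul_support(2)[OF nz] assms unfolding superpolys_def by blast
    fix a assume "a \<in> Poly_Mapping.keys (gmul (gcoeff f) (gcoeff g) U)"
    then obtain S where "a \<in> Poly_Mapping.keys (gsign S (U - S) * gcoeff f S * gcoeff g (U - S))"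
      unfolding gmul_def using keys_sum[THEN subsetD] by (metis (no_types, lifting) UN_E)
    moreover have "gsign S (U - S) * gcoeff f S * gcoeff g (U - S) = gcoeff f S * gcoeff g (U - S) \<or>
        gsign S (U - S) * gcoeff f S * gcoeff g (U - S) = - (gcoeff f S * gcoeff g (U - S))"
      by (simp add: gsign_def minus_one_power_iff)
    ultimately have "a \<in> Poly_Mapping.keys (gcoeff f S * gcoeff g (U - S))"
      by (metis keys_uminus_eq)
    then obtain b c where bc: "a = b + c" "b \<in> Poly_Mapping.keys (gcoeff f S)"
        "c \<in> Poly_Mapping.keys (gcoeff g (U - S))"
      using keys_mult[of "gcoeff f S" "gcoeff g (U - S)"] by auto
    then have "Poly_Mapping.keys b \<subseteq> evars p q m n" "Poly_Mapping.keys c \<subseteq> evars p q m n"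
      using keys_superpolys[OF assms(1) bc(2)] keys_superpolys[OF assms(2) bc(3)] by simp_all
    then show "Poly_Mapping.keys a \<subseteq> evars p q m n"
      using order_trans[OF Poly_Mapping.keys_add[of b c] Un_least] bc(1) by simp
  qed
  then show ?thesis by (simp add: superpolys_def times_grassmann.rep_eq)
qed

lemma superpolys_prod_list:
  "(\<And>i. i \<in> set xs \<Longrightarrow> f i \<in> superpolys p q m n) \<Longrightarrow> prod_list (map f xs) \<in> superpolys p q m n"
  by (induction xs) (auto intro: superpolys_mult superpolys_1)

lemma superpolys_rdet:
  assumes "\<And>i j. i \<in> {1..k} \<Longrightarrow> j \<in> {1..k} \<Longrightarrow> A i j \<in> superpolys p q m n"
  shows "rdet k A \<in> superpolys p q m n"
proof -
  have "prod_list (map (\<lambda>i. A i (\<sigma> i)) [1..<Suc k]) \<in> superpolys p q m n"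
    if "\<sigma> permutes {1..k}" for \<sigma>
  proof (rule superpolys_prod_list)
    fix i assume "i \<in> set [1..<Suc k]"
    then have i: "i \<in> {1..k}" by auto
    with that have "\<sigma> i \<in> {1..k}" by (simp only: permutes_in_image)
    with i show "A i (\<sigma> i) \<in> superpolys p q m n" by (rule assms)
  qed
  then show ?thesis
    unfolding rdet_def by (intro superpolys_sum) (auto simp: sign_def intro: superpolys_uminus)
qed

lemma superpolys_generators:
  "l \<in> {1..m} \<Longrightarrow> i \<in> {1..p} \<Longrightarrow> xv l i \<in> superpolys p q m n"
  "k \<in> {1..n} \<Longrightarrow> j \<in> {1..q} \<Longrightarrow> yv k j \<in> superpolys p q m n"
  "l \<in> {1..m} \<Longrightarrow> j \<in> {1..q} \<Longrightarrow> xiv l j \<in> superpolys p q m n"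
  "k \<in> {1..n} \<Longrightarrow> i \<in> {1..p} \<Longrightarrow> etav k i \<in> superpolys p q m n"
  by (auto simp: superpolys_def xv_def yv_def xiv_def etav_def evgen_def gconst.rep_eq
      godd.rep_eq evars_def ovars_def keys_one)

section \<open>Row-order determinants\<close>

lemma rdet_cong:
  assumes "\<And>i j. i \<in> {1..k} \<Longrightarrow> j \<in> {1..k} \<Longrightarrow> A i j = B i j"
  shows "rdet k A = rdet k B"
proof -
  have "map (\<lambda>i. A i (\<sigma> i)) [1..<Suc k] = map (\<lambda>i. B i (\<sigma> i)) [1..<Suc k]"
    if "\<sigma> permutes {1..k}" for \<sigma>
  proof (rule map_cong[OF refl])
    fix i assume "i \<in> set [1..<Suc k]"
    then have i: "i \<in> {1..k}" by auto
    with that have "\<sigma> i \<in> {1..k}" by (simp only: permutes_in_image)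
    with i show "A i (\<sigma> i) = B i (\<sigma> i)" by (rule assms)
  qed
  then show ?thesis unfolding rdet_def by (intro sum.cong refl) (simp only: mem_Collect_eq)
qed

lemma prod_list_hom:
  assumes "\<And>a b. h (a * b) = h a * h b" "h 1 = 1"
  shows "h (prod_list (map f xs)) = prod_list (map (\<lambda>i. h (f i)) xs)"
  by (induction xs) (simp_all add: assms)

lemma rdet_body_at: "body_at V (rdet k A) = rdet k (\<lambda>i j. body_at V (A i j))"
proof -
  have sum: "body_at V (sum f I) = (\<Sum>i\<in>I. body_at V (f i))" for f and I :: "(nat \<Rightarrow> nat) set"
    by (induction I rule: infinite_finite_induct) (simp_all add: body_at_add)
  have "body_at V (- f) = - body_at V f" for f
    using body_at_add[of V f "- f"] by (simp add: eq_neg_iff_add_eq_0 add.commute)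
  then have "body_at V (of_int (sign \<sigma>) * f) = of_int (sign \<sigma>) * body_at V f" for \<sigma> :: "nat \<Rightarrow> nat" and f
    by (simp add: sign_def)
  then show ?thesis
    by (simp only: rdet_def sum prod_list_hom[of "body_at V", OF body_at_mult body_at_1])
qed

lemma rdet_mult_prod: "rdet k A = (\<Sum>\<sigma> | \<sigma> permutes {1..k}. of_int (sign \<sigma>) * (\<Prod>i=1..k. A i (\<sigma> i)))"
  for A :: "nat \<Rightarrow> nat \<Rightarrow> 'a::comm_ring_1"
  unfolding rdet_def
  by (intro sum.cong refl, subst prod.distinct_set_conv_list[symmetric])
    (auto intro!: arg_cong2[of _ _ _ _ "(*)"] prod.cong)

lemma rdet_diagonal:
  fixes A :: "nat \<Rightarrow> nat \<Rightarrow> 'a::comm_ring_1"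
  assumes "\<And>i j. i \<in> {1..k} \<Longrightarrow> j \<in> {1..k} \<Longrightarrow> i \<noteq> j \<Longrightarrow> A i j = 0"
  shows "rdet k A = (\<Prod>i=1..k. A i i)"
proof -
  have "(\<Prod>i=1..k. A i (\<sigma> i)) = 0" if \<sigma>: "\<sigma> permutes {1..k}" and ne: "\<sigma> \<noteq> id" for \<sigma>
  proof -
    obtain i where i: "\<sigma> i \<noteq> i" using ne by (auto simp: fun_eq_iff)
    then have "i \<in> {1..k}" using \<sigma> by (meson permutes_not_in)
    moreover from this have "\<sigma> i \<in> {1..k}" using \<sigma> by (simp only: permutes_in_image)
    ultimately show ?thesis using i by (intro prod_zero) (auto intro!: assms)
  qed
  then have "rdet k A = (\<Sum>\<sigma>\<in>{id}. of_int (sign \<sigma>) * (\<Prod>i=1..k. A i (\<sigma> i)))"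
    unfolding rdet_mult_prod
    by (intro sum.mono_neutral_right) (auto simp: finite_permutations permutes_id)
  then show ?thesis by simp
qed

text \<open>
  In row order, composing a permutation with the transposition of two columns keeps every factor in
  its place; if these columns are equal, the product is the same, but the sign changes.
\<close>

lemma rdet_equal_columns:
  assumes "c \<in> {1..k}" "c' \<in> {1..k}" "c \<noteq> c'" "\<And>i. i \<in> {1..k} \<Longrightarrow> A i c = A i c'"
  shows "rdet k A = - rdet k A"
proof -
  let ?t = "transpose c c'"
  have t: "?t permutes {1..k}" using assms by (intro permutes_swap_id)
  have "rdet k A = (\<Sum>\<sigma> | \<sigma> permutes {1..k}.
      of_int (sign (?t \<circ> \<sigma>)) * prod_list (map (\<lambda>i. A i ((?t \<circ> \<sigma>) i)) [1..<Suc k]))"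
    unfolding rdet_def by (rule setum_permutations_compose_left[OF t])
  also have "\<dots> = (\<Sum>\<sigma> | \<sigma> permutes {1..k}.
      - (of_int (sign \<sigma>) * prod_list (map (\<lambda>i. A i (\<sigma> i)) [1..<Suc k])))"
  proof (intro sum.cong refl, unfold mem_Collect_eq)
    fix \<sigma> assume \<sigma>: "\<sigma> permutes {1..k}"
    have "sign (?t \<circ> \<sigma>) = - sign \<sigma>"
      using \<sigma> t assms(3) by (subst sign_compose)
        (auto intro: permutation_permutes[THEN iffD2] simp: sign_swap_id permutation_swap_id)
    moreover have "map (\<lambda>i. A i ((?t \<circ> \<sigma>) i)) [1..<Suc k] = map (\<lambda>i. A i (\<sigma> i)) [1..<Suc k]"
      using assms(4) by (intro map_cong refl) (auto simp: transpose_def)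
    ultimately show "of_int (sign (?t \<circ> \<sigma>)) * prod_list (map (\<lambda>i. A i ((?t \<circ> \<sigma>) i)) [1..<Suc k])
        = - (of_int (sign \<sigma>) * prod_list (map (\<lambda>i. A i (\<sigma> i)) [1..<Suc k]))"
      by (simp del: upt_Suc map_eq_conv)
  qed
  finally show ?thesis by (simp add: rdet_def sum_negf del: upt_Suc)
qed

text \<open>
  Here the transposition exchanges two adjacent factors, both from the repeated row; this is where
  entries of that row in different columns must commute.
\<close>

lemma rdet_equal_rows:
  assumes "1 \<le> s" "s < k" "\<And>j. j \<in> {1..k} \<Longrightarrow> A (Suc s) j = A s j"
    and "\<And>j j'. j \<in> {1..k} \<Longrightarrow> j' \<in> {1..k} \<Longrightarrow> j \<noteq> j' \<Longrightarrow> A s j * A s j' = A s j' * A s j"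
  shows "rdet k A = - rdet k A"
proof -
  let ?t = "transpose s (Suc s)"
  have t: "?t permutes {1..k}" using assms by (intro permutes_swap_id) auto
  have rows: "[1..<Suc k] = [1..<s] @ s # Suc s # [Suc (Suc s)..<Suc k]"
    using assms(1,2) upt_add_eq_append[of 1 s "Suc k - s"]
    by (simp add: upt_conv_Cons del: upt_Suc)
  have "rdet k A = (\<Sum>\<sigma> | \<sigma> permutes {1..k}.
      of_int (sign (\<sigma> \<circ> ?t)) * prod_list (map (\<lambda>i. A i ((\<sigma> \<circ> ?t) i)) [1..<Suc k]))"
    unfolding rdet_def by (rule sum_permutations_compose_right[OF t])
  also have "\<dots> = (\<Sum>\<sigma> | \<sigma> permutes {1..k}.
      - (of_int (sign \<sigma>) * prod_list (map (\<lambda>i. A i (\<sigma> i)) [1..<Suc k])))"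
  proof (intro sum.cong refl, unfold mem_Collect_eq)
    fix \<sigma> assume \<sigma>: "\<sigma> permutes {1..k}"
    have sgn: "sign (\<sigma> \<circ> ?t) = - sign \<sigma>"
      using \<sigma> t by (subst sign_compose)
        (auto intro: permutation_permutes[THEN iffD2] simp: sign_swap_id permutation_swap_id)
    have in_range: "\<sigma> s \<in> {1..k}" "\<sigma> (Suc s) \<in> {1..k}"
      using permutes_in_image[OF \<sigma>] assms(1,2) by auto
    have ne: "\<sigma> s \<noteq> \<sigma> (Suc s)"
      using permutes_inj[OF \<sigma>] by (metis inj_eq n_not_Suc_n)
    have "A s (\<sigma> (Suc s)) * (A (Suc s) (\<sigma> s) * P) = A s (\<sigma> s) * (A (Suc s) (\<sigma> (Suc s)) * P)" for P
      using assms(4)[OF in_range ne] 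
      by (simp add: assms(3)[OF in_range(1)] assms(3)[OF in_range(2)] flip: mult.assoc)
    moreover have "map (\<lambda>i. A i ((\<sigma> \<circ> ?t) i)) [1..<s] = map (\<lambda>i. A i (\<sigma> i)) [1..<s]"
      "map (\<lambda>i. A i ((\<sigma> \<circ> ?t) i)) [Suc (Suc s)..<Suc k] = map (\<lambda>i. A i (\<sigma> i)) [Suc (Suc s)..<Suc k]"
      by (intro map_cong refl; auto simp: transpose_def)+
    ultimately show "of_int (sign (\<sigma> \<circ> ?t)) * prod_list (map (\<lambda>i. A i ((\<sigma> \<circ> ?t) i)) [1..<Suc k])
        = - (of_int (sign \<sigma>) * prod_list (map (\<lambda>i. A i (\<sigma> i)) [1..<Suc k]))"
      unfolding rows sgn by (simp del: upt_Suc map_eq_conv)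
  qed
  finally show ?thesis by (simp add: rdet_def sum_negf del: upt_Suc)
qed

section \<open>Superderivations of determinants\<close>

lemma superderivation_prod_list_0:
  assumes "superderivation d D" "\<And>i. i \<in> set xs \<Longrightarrow> has_parity (e i) (g i)"
    "\<And>i. i \<in> set xs \<Longrightarrow> D (g i) = 0"
  shows "D (prod_list (map g xs)) = 0"
  using assms(2,3)
proof (induction xs)
  case (Cons x xs)
  then show ?case using superderivation_leibniz[OF assms(1), of "e x" "g x"] by simp
qed (simp add: superderivation_1[OF assms(1)])

text \<open>
  A product in which \<open>D\<close> acts on a single factor only.  An odd \<open>D\<close> is moved past the factors
  to the left of that one; they are then assumed to be even, so that no sign appears.
\<close>

lemma superderivation_prod_list:
  fixes xs :: "'a::linorder list"
  assumes "superderivation d D" "sorted_wrt (<) xs" "i0 \<in> set xs"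
    "\<And>i. i \<in> set xs \<Longrightarrow> has_parity (e i) (g i)"
    "\<And>i. i \<in> set xs \<Longrightarrow> i \<noteq> i0 \<Longrightarrow> D (g i) = 0"
    "\<And>i. i \<in> set xs \<Longrightarrow> i < i0 \<Longrightarrow> d \<Longrightarrow> \<not> e i"
  shows "D (prod_list (map g xs)) = prod_list (map (\<lambda>i. if i = i0 then D (g i) else g i) xs)"
  using assms(2-6)
proof (induction xs)
  case (Cons x xs)
  note leibniz = superderivation_leibniz[OF assms(1) Cons.prems(3)[OF list.set_intros(1)]]
  show ?case
  proof (cases "x = i0")
    case True
    then have "i0 \<notin> set xs" using Cons.prems(1) by auto
    then have "D (prod_list (map g xs)) = 0"
      using Cons.prems by (intro superderivation_prod_list_0[OF assms(1), of _ e]) auto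
    moreover have "map (\<lambda>i. if i = i0 then D (g i) else g i) xs = map g xs"
      using \<open>i0 \<notin> set xs\<close> by (intro map_cong) auto
    ultimately show ?thesis using True by (simp add: leibniz[unfolded True] del: map_eq_conv)
  next
    case False
    then have "\<not> (d \<and> e x)" using Cons.prems(1,2) Cons.prems(5)[of x] by auto
    then have "D (prod_list (map g (x # xs))) = D (g x) * prod_list (map g xs) + g x * D (prod_list (map g xs))"
      by (simp only: list.map prod_list.Cons leibniz if_False)
    then show ?thesis using Cons False by simp
  qed
qed simp

lemma superderivation_rdet_0:
  assumes D: "superderivation d D"
    and par: "\<And>i j. i \<in> {1..k} \<Longrightarrow> j \<in> {1..k} \<Longrightarrow> has_parity (e i j) (A i j)"
    and zero: "\<And>i j. i \<in> {1..k} \<Longrightarrow> j \<in> {1..k} \<Longrightarrow> D (A i j) = 0"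
  shows "D (rdet k A) = 0"
proof -
  have "D (prod_list (map (\<lambda>i. A i (\<sigma> i)) [1..<Suc k])) = 0" if "\<sigma> permutes {1..k}" for \<sigma>
  proof (rule superderivation_prod_list_0[OF D, of _ "\<lambda>i. e i (\<sigma> i)"])
    fix i assume "i \<in> set [1..<Suc k]"
    then have i: "i \<in> {1..k}" by auto
    with that have "\<sigma> i \<in> {1..k}" by (simp only: permutes_in_image)
    with i show "has_parity (e i (\<sigma> i)) (A i (\<sigma> i))" "D (A i (\<sigma> i)) = 0"
      by (intro par zero; simp)+
  qed
  then show ?thesis
    by (simp add: rdet_def superderivation_sum[OF D] superderivation_sign[OF D] del: upt_Suc)
qed

text \<open>
  Each product in the determinant has exactly one factor from column \<open>c\<close>.  The factors to its left
  come from rows above it, hence not from the last row; so an odd \<open>D\<close> allows odd entries outside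
  column \<open>c\<close> in the last row.
\<close>

lemma superderivation_rdet_column:
  assumes D: "superderivation d D" and c: "c \<in> {1..k}"
    and par: "\<And>i j. i \<in> {1..k} \<Longrightarrow> j \<in> {1..k} \<Longrightarrow> has_parity (e i j) (A i j)"
    and zero: "\<And>i j. i \<in> {1..k} \<Longrightarrow> j \<in> {1..k} \<Longrightarrow> j \<noteq> c \<Longrightarrow> D (A i j) = 0"
    and even: "\<And>i j. i \<in> {1..<k} \<Longrightarrow> j \<in> {1..k} \<Longrightarrow> j \<noteq> c \<Longrightarrow> d \<Longrightarrow> \<not> e i j"
  shows "D (rdet k A) = rdet k (\<lambda>i j. if j = c then D (A i j) else A i j)"
proof -
  have "D (prod_list (map (\<lambda>i. A i (\<sigma> i)) [1..<Suc k])) =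
      prod_list (map (\<lambda>i. if \<sigma> i = c then D (A i (\<sigma> i)) else A i (\<sigma> i)) [1..<Suc k])"
    if \<sigma>: "\<sigma> permutes {1..k}" for \<sigma>
  proof -
    have iff: "i = inv \<sigma> c \<longleftrightarrow> \<sigma> i = c" for i
      using \<sigma> by (metis permutes_inverses)
    have "inv \<sigma> c \<in> {1..k}"
      using permutes_in_image[OF permutes_inv[OF \<sigma>]] c by simp
    then have "D (prod_list (map (\<lambda>i. A i (\<sigma> i)) [1..<Suc k])) =
      prod_list (map (\<lambda>i. if i = inv \<sigma> c then D (A i (\<sigma> i)) else A i (\<sigma> i)) [1..<Suc k])"
    proof (intro superderivation_prod_list[OF D, of _ _ "\<lambda>i. e i (\<sigma> i)"])
      fix i assume "i \<in> set [1..<Suc k]"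
      then have i: "i \<in> {1..k}" by auto
      with \<sigma> have \<sigma>i: "\<sigma> i \<in> {1..k}" by (simp only: permutes_in_image)
      from i \<sigma>i show "has_parity (e i (\<sigma> i)) (A i (\<sigma> i))" by (rule par)
      show "D (A i (\<sigma> i)) = 0" if "i \<noteq> inv \<sigma> c"
        using i \<sigma>i that by (intro zero) (simp_all add: iff)
      show "\<not> e i (\<sigma> i)" if "i < inv \<sigma> c" d
      proof (rule even)
        show "i \<in> {1..<k}" using i that(1) \<open>inv \<sigma> c \<in> {1..k}\<close> by auto
        show "\<sigma> i \<noteq> c" using that(1) iff[of i] by auto
      qed (use \<sigma>i that in auto)
    qed (use \<open>inv \<sigma> c \<in> {1..k}\<close> in \<open>auto simp: sorted_wrt_upt simp del: upt_Suc\<close>)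
    then show ?thesis by (simp only: iff)
  qed
  then show ?thesis
    by (simp add: rdet_def superderivation_sum[OF D] superderivation_sign[OF D] del: upt_Suc)
qed

text \<open>
  Each product has exactly one factor from row \<open>s\<close>.  Unlike for columns, an odd operator would in
  general meet different signs in different products.
\<close>

lemma derivation_rdet_row:
  assumes D: "superderivation d D" and s: "s \<in> {1..k}"
    and par: "\<And>i j. i \<in> {1..k} \<Longrightarrow> j \<in> {1..k} \<Longrightarrow> has_parity (e i j) (A i j)"
    and zero: "\<And>i j. i \<in> {1..k} \<Longrightarrow> j \<in> {1..k} \<Longrightarrow> i \<noteq> s \<Longrightarrow> D (A i j) = 0"
    and even: "\<not> d"
  shows "D (rdet k A) = rdet k (\<lambda>i j. if i = s then D (A i j) else A i j)"
proof -
  have "D (prod_list (map (\<lambda>i. A i (\<sigma> i)) [1..<Suc k])) =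
      prod_list (map (\<lambda>i. if i = s then D (A i (\<sigma> i)) else A i (\<sigma> i)) [1..<Suc k])"
    if \<sigma>: "\<sigma> permutes {1..k}" for \<sigma>
  proof (intro superderivation_prod_list[OF D, of _ _ "\<lambda>i. e i (\<sigma> i)"])
    fix i assume "i \<in> set [1..<Suc k]"
    then have i: "i \<in> {1..k}" by auto
    with \<sigma> have \<sigma>i: "\<sigma> i \<in> {1..k}" by (simp only: permutes_in_image)
    from i \<sigma>i show "has_parity (e i (\<sigma> i)) (A i (\<sigma> i))" by (rule par)
    show "D (A i (\<sigma> i)) = 0" if "i \<noteq> s" using i \<sigma>i that by (rule zero)
  qed (use s even in \<open>auto simp: sorted_wrt_upt simp del: upt_Suc\<close>)
  then show ?thesis
    by (simp add: rdet_def superderivation_sum[OF D] superderivation_sign[OF D] del: upt_Suc)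
qed

lemma derivation_rdet_eigen:
  assumes D: "superderivation False D"
    and par: "\<And>i j. i \<in> {1..k} \<Longrightarrow> j \<in> {1..k} \<Longrightarrow> has_parity (e i j) (A i j)"
    and eigen: "\<And>i j. i \<in> {1..k} \<Longrightarrow> j \<in> {1..k} \<Longrightarrow> D (A i j) = A i j"
  shows "D (rdet k A) = of_nat k * rdet k A"
proof -
  have prod: "D (prod_list (map g xs)) = of_nat (length xs) * prod_list (map g xs)"
    if "\<And>i. i \<in> set xs \<Longrightarrow> \<exists>e. has_parity e (g i)" "\<And>i. i \<in> set xs \<Longrightarrow> D (g i) = g i"
    for g and xs :: "nat list"
    using that
  proof (induction xs)
    case (Cons x xs)
    then obtain e where "has_parity e (g x)" by auto
    from superderivation_leibniz[OF D this] Cons show ?case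
      by (simp add: distrib_right mult.assoc mult_of_nat_commute)
  qed (simp add: superderivation_1[OF D])
  have "D (prod_list (map (\<lambda>i. A i (\<sigma> i)) [1..<Suc k])) =
      of_nat k * prod_list (map (\<lambda>i. A i (\<sigma> i)) [1..<Suc k])"
    if "\<sigma> permutes {1..k}" for \<sigma>
  proof -
    have "(\<exists>e. has_parity e (A i (\<sigma> i))) \<and> D (A i (\<sigma> i)) = A i (\<sigma> i)"
      if "i \<in> set [1..<Suc k]" for i
    proof -
      have i: "i \<in> {1..k}" using that by auto
      with \<open>\<sigma> permutes {1..k}\<close> have "\<sigma> i \<in> {1..k}" by (simp only: permutes_in_image)
      with i show ?thesis using par eigen by blast
    qed
    then show ?thesis by (subst prod) (auto simp del: upt_Suc)
  qed
  then show ?thesis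
    by (simp add: rdet_def superderivation_sum[OF D] superderivation_sign[OF D] sum_distrib_left
        mult.left_commute mult_of_nat_commute mult.assoc del: upt_Suc)
qed

section \<open>\<open>\<Gamma>\<^sub>r\<close> as a determinant of bordered determinants\<close>

lemma has_parity_prod_list:
  assumes "distinct xs" "\<And>i. i \<in> set xs \<Longrightarrow> has_parity (e i) (g i)"
  shows "has_parity (odd (card {i \<in> set xs. e i})) (prod_list (map g xs))"
  using assms
proof (induction xs)
  case (Cons x xs)
  have "{i \<in> set (x # xs). e i} = (if e x then insert x {i \<in> set xs. e i} else {i \<in> set xs. e i})"
    by auto
  then have "odd (card {i \<in> set (x # xs). e i}) = (e x \<noteq> odd (card {i \<in> set xs. e i}))"
    using Cons.prems(1) by simp
  then show ?case
    using has_parity_mult[OF Cons.prems(2)[of x] Cons.IH] Cons.prems by simp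
qed simp

lemma has_parity_sign: "has_parity e f \<Longrightarrow> has_parity e (of_int (sign \<sigma>) * f)"
  by (simp add: sign_def)

lemma has_parity_rdet:
  assumes "\<And>i j. i \<in> {1..k} \<Longrightarrow> j \<in> {1..k} \<Longrightarrow> has_parity (e i) (A i j)"
  shows "has_parity (odd (card {i \<in> {1..k}. e i})) (rdet k A)"
proof -
  have "has_parity (odd (card {i \<in> set [1..<Suc k]. e i})) (prod_list (map (\<lambda>i. A i (\<sigma> i)) [1..<Suc k]))"
    if \<sigma>: "\<sigma> permutes {1..k}" for \<sigma>
  proof (intro has_parity_prod_list)
    fix i assume "i \<in> set [1..<Suc k]"
    then have i: "i \<in> {1..k}" by auto
    with \<sigma> have "\<sigma> i \<in> {1..k}" by (simp only: permutes_in_image)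
    with i show "has_parity (e i) (A i (\<sigma> i))" by (rule assms)
  qed auto
  moreover have "set [1..<Suc k] = {1..k}" by auto
  ultimately show ?thesis
    unfolding rdet_def by (intro has_parity_sum has_parity_sign) (simp only: mem_Collect_eq)
qed

text \<open>
  The matrix \<open>X\<close> of the \<open>x_l^j\<close> bordered by the column of the \<open>\<xi>_l^k\<close> on the right, by the row
  of the \<open>\<eta>_a^j\<close> below, and by \<open>y_a^k\<close> in the corner.
\<close>

definition bordered :: "nat \<Rightarrow> nat \<Rightarrow> nat \<Rightarrow> nat \<Rightarrow> nat \<Rightarrow> superpoly"
  where "bordered m a k i j =
    (if i \<le> m then if j \<le> m then xv i j else xiv i k else if j \<le> m then etav a j else yv a k)"

definition border_det :: "nat \<Rightarrow> nat \<Rightarrow> nat \<Rightarrow> superpoly"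
  where "border_det m a k = rdet (Suc m) (bordered m a k)"

text \<open>
  The permutations of \<open>{1..Suc m}\<close> grouped by the row \<open>b\<close> that is sent to the last column.
\<close>

lemma rdet_Suc_sum:
  "rdet (Suc m) A = (\<Sum>b\<in>insert (Suc m) {1..m}. \<Sum>q | q permutes {1..m}.
    of_int (sign (q \<circ> transpose (Suc m) b)) *
      prod_list (map (\<lambda>i. A i ((q \<circ> transpose (Suc m) b) i)) [1..<Suc (Suc m)]))"
proof -
  define F where "F p = of_int (sign p) * prod_list (map (\<lambda>i. A i (p i)) [1..<Suc (Suc m)])" for p
  have ins: "{1..Suc m} = insert (Suc m) {1..m}" by auto
  have "rdet (Suc m) A = (\<Sum>p | p permutes insert (Suc m) {1..m}. F p)"
    by (simp only: rdet_def F_def ins)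
  also have "\<dots> = (\<Sum>p | p permutes insert (Suc m) {1..m}. F (inv p))"
    by (rule sum_permutations_inverse)
  also have "\<dots> = (\<Sum>b\<in>insert (Suc m) {1..m}. \<Sum>q | q permutes {1..m}.
      F (inv (transpose (Suc m) b \<circ> q)))"
    by (rule sum_over_permutations_insert) auto
  also have "\<dots> = (\<Sum>b\<in>insert (Suc m) {1..m}. \<Sum>q | q permutes {1..m}.
      F (inv q \<circ> transpose (Suc m) b))"
    by (intro sum.cong refl arg_cong[of _ _ F], subst o_inv_distrib)
      (auto intro: permutes_bij)
  also have "\<dots> = (\<Sum>b\<in>insert (Suc m) {1..m}. \<Sum>q | q permutes {1..m}.
      F (q \<circ> transpose (Suc m) b))"
  proof (rule sum.cong[OF refl])
    show "(\<Sum>q | q permutes {1..m}. F (inv q \<circ> transpose (Suc m) b)) =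
        (\<Sum>q | q permutes {1..m}. F (q \<circ> transpose (Suc m) b))" for b
      by (rule sum_permutations_inverse[of "\<lambda>q. F (q \<circ> transpose (Suc m) b)", symmetric])
  qed
  finally show ?thesis by (simp only: F_def)
qed

text \<open>
  Expansion along the last column.  If row \<open>j \<le> m\<close> is sent to the last column, the product contains
  \<open>\<xi>_j^k\<close> in position \<open>j\<close> and an \<open>\<eta>\<close> at the end.  Exchanging these two odd factors past even ones
  gives a sign, and so does the transposition that turns the permutation into one of \<open>{1..m}\<close>; the
  two signs cancel.  This is why every term has a plus sign here.
\<close>

lemma border_det_expand:
  "border_det m a k = rdet m xv * yv a k +
    (\<Sum>j=1..m. rdet m (\<lambda>i c. if i = j then etav a c else xv i c) * xiv j k)"
proof -
  define B where "B = bordered m a k"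
  define F where "F p = of_int (sign p) * prod_list (map (\<lambda>i. B i (p i)) [1..<Suc (Suc m)])" for p
  have F_eq: "F p = of_int (sign p) *
      (prod_list (map (\<lambda>i. B i (p i)) [1..<Suc m]) * B (Suc m) (p (Suc m)))" for p
  proof -
    have "[1..<Suc (Suc m)] = [1..<Suc m] @ [Suc m]" by simp
    then show ?thesis by (simp only: F_def map_append prod_list.append) simp
  qed
  have fixed: "F (q \<circ> transpose (Suc m) (Suc m)) =
      of_int (sign q) * prod_list (map (\<lambda>i. xv i (q i)) [1..<Suc m]) * yv a k"
    if q: "q permutes {1..m}" for q
  proof -
    have "map (\<lambda>i. B i (q i)) [1..<Suc m] = map (\<lambda>i. xv i (q i)) [1..<Suc m]"
    proof (intro map_cong refl)
      fix i assume "i \<in> set [1..<Suc m]"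
      then have "i \<in> {1..m}" by auto
      moreover from this q have "q i \<in> {1..m}" by (simp only: permutes_in_image)
      ultimately show "B i (q i) = xv i (q i)" by (simp add: B_def bordered_def)
    qed
    moreover have "q (Suc m) = Suc m" using q by (rule permutes_not_in) simp
    moreover have "B (Suc m) (Suc m) = yv a k" by (simp add: B_def bordered_def)
    ultimately show ?thesis
      by (simp add: F_eq mult.assoc del: upt_Suc map_eq_conv)
  qed
  have moved: "F (q \<circ> transpose (Suc m) j) = of_int (sign q) *
      prod_list (map (\<lambda>i. if i = j then etav a (q i) else xv i (q i)) [1..<Suc m]) * xiv j k"
    if q: "q permutes {1..m}" and j: "j \<in> {1..m}" for q j
  proof -
    let ?t = "transpose (Suc m) j"
    have rows: "[1..<Suc m] = [1..<j] @ j # [Suc j..<Suc m]"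
      using j upt_add_eq_append[of 1 j "Suc m - j"] by (simp add: upt_conv_Cons del: upt_Suc)
    have t: "sign (q \<circ> ?t) = - sign q"
      using q j by (subst sign_compose)
        (auto intro: permutation_permutes[THEN iffD2] simp: sign_swap_id permutation_swap_id)
    have qi: "q i \<in> {1..m}" if "i \<in> {1..m}" for i
      using q that by (simp only: permutes_in_image)
    have qm: "q (Suc m) = Suc m" using q by (rule permutes_not_in) simp
    have other: "B i ((q \<circ> ?t) i) = xv i (q i)" if "i \<in> {1..m}" "i \<noteq> j" for i
      using that qi[OF that(1)] by (simp add: B_def bordered_def transpose_def)
    define P where "P = prod_list (map (\<lambda>i. xv i (q i)) [1..<j])"
    define Q where "Q = prod_list (map (\<lambda>i. xv i (q i)) [Suc j..<Suc m])"
    have "map (\<lambda>i. B i ((q \<circ> ?t) i)) [1..<j] = map (\<lambda>i. xv i (q i)) [1..<j]"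
      "map (\<lambda>i. B i ((q \<circ> ?t) i)) [Suc j..<Suc m] = map (\<lambda>i. xv i (q i)) [Suc j..<Suc m]"
      using j by (intro map_cong refl other; auto)+
    moreover have "B j ((q \<circ> ?t) j) = xiv j k"
      using j qm by (simp add: B_def bordered_def)
    moreover have "B (Suc m) ((q \<circ> ?t) (Suc m)) = etav a (q j)"
      using qi[OF j] by (simp add: B_def bordered_def)
    ultimately have "F (q \<circ> ?t) = - (of_int (sign q) * (P * (xiv j k * (Q * etav a (q j)))))"
      unfolding F_eq rows
      by (simp add: t P_def Q_def mult.assoc
          del: upt_Suc map_eq_conv)
    also have "xiv j k * (Q * etav a (q j)) = - (etav a (q j) * (Q * xiv j k))"
    proof -
      have "has_parity (odd (card {i \<in> set [Suc j..<Suc m]. False})) Q"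
        unfolding Q_def by (intro has_parity_prod_list) auto
      then have Q: "has_parity False Q" by simp
      have "Q * etav a (q j) = etav a (q j) * Q" "Q * xiv j k = xiv j k * Q"
        by (rule even_commute[OF Q has_parity_generators(4)])
          (rule even_commute[OF Q has_parity_generators(3)])
      moreover have "xiv j k * etav a (q j) = - (etav a (q j) * xiv j k)"
        by (rule odd_anticommute) simp_all
      ultimately show ?thesis by (simp flip: mult.assoc)
    qed
    also have "- (of_int (sign q) * (P * - (etav a (q j) * (Q * xiv j k)))) = of_int (sign q) *
      prod_list (map (\<lambda>i. if i = j then etav a (q i) else xv i (q i)) [1..<Suc m]) * xiv j k"
    proof -
      have "map (\<lambda>i. if i = j then etav a (q i) else xv i (q i)) [1..<j] = map (\<lambda>i. xv i (q i)) [1..<j]"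
        "map (\<lambda>i. if i = j then etav a (q i) else xv i (q i)) [Suc j..<Suc m] = map (\<lambda>i. xv i (q i)) [Suc j..<Suc m]"
        by (intro map_cong refl; auto)+
      then show ?thesis
        unfolding rows
        by (simp add: P_def Q_def mult.assoc del: upt_Suc map_eq_conv)
    qed
    finally show ?thesis .
  qed
  have "border_det m a k = (\<Sum>b\<in>insert (Suc m) {1..m}. \<Sum>q | q permutes {1..m}. F (q \<circ> transpose (Suc m) b))"
    unfolding border_det_def F_def B_def by (rule rdet_Suc_sum)
  also have "\<dots> = (\<Sum>q | q permutes {1..m}. F (q \<circ> transpose (Suc m) (Suc m))) +
      (\<Sum>j=1..m. \<Sum>q | q permutes {1..m}. F (q \<circ> transpose (Suc m) j))"
    by (rule sum.insert) auto
  also have "(\<Sum>q | q permutes {1..m}. F (q \<circ> transpose (Suc m) (Suc m))) = rdet m xv * yv a k"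
    unfolding rdet_def sum_distrib_right by (intro sum.cong refl fixed) simp
  also have "(\<Sum>j=1..m. \<Sum>q | q permutes {1..m}. F (q \<circ> transpose (Suc m) j)) =
    (\<Sum>j=1..m. rdet m (\<lambda>i c. if i = j then etav a c else xv i c) * xiv j k)"
    unfolding rdet_def sum_distrib_right by (intro sum.cong refl moved) simp_all
  finally show ?thesis .
qed

lemma has_parity_X: "has_parity False (rdet m xv)"
  using has_parity_rdet[of m "\<lambda>_. False" xv] by simp

lemma has_parity_X_replaced:
  assumes "j \<in> {1..m}"
  shows "has_parity True (rdet m (\<lambda>i c. if i = j then etav a c else xv i c))"
proof -
  have "{i \<in> {1..m}. i = j} = {j}" using assms by auto
  then show ?thesis
    using has_parity_rdet[of m "\<lambda>i. i = j" "\<lambda>i c. if i = j then etav a c else xv i c"] by simp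
qed

lemma has_parity_border_det: "has_parity False (border_det m a k)"
proof -
  have "has_parity False (rdet m xv * yv a k)"
    using has_parity_mult[OF has_parity_X has_parity_generators(2)] by simp
  moreover have "has_parity False (rdet m (\<lambda>i c. if i = j then etav a c else xv i c) * xiv j k)"
    if "j \<in> {1..m}" for j
    using has_parity_mult[OF has_parity_X_replaced[OF that] has_parity_generators(3)] by simp
  ultimately show ?thesis
    unfolding border_det_expand by (intro has_parity_add has_parity_sum)
qed

lemma marked_diagrams_0: "marked_diagrams m 0 = {{}}"
  by (auto simp: marked_diagrams_def)

text \<open>
  The last column of a diagram is unmarked or is marked in one of the rows \<open>1\<close>, ..., \<open>m\<close>.
\<close>

lemma sum_marked_diagrams_Suc:
  "(\<Sum>D\<in>marked_diagrams m (Suc r). h D) =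
    (\<Sum>D\<in>marked_diagrams m r. h D + (\<Sum>j=1..m. h (insert (j, Suc r) D)))"
proof -
  let ?f = "\<lambda>(D, j). insert (j, Suc r) D"
  have fin: "finite (marked_diagrams m r)"
    by (rule finite_subset[of _ "Pow ({1..m} \<times> {1..r})"]) (auto simp: marked_diagrams_def)
  have new: "(j, Suc r) \<notin> D" if "D \<in> marked_diagrams m r" for D j
    using that by (auto simp: marked_diagrams_def)
  have "marked_diagrams m (Suc r) = marked_diagrams m r \<union> ?f ` (marked_diagrams m r \<times> {1..m})"
  proof (intro equalityI subsetI)
    fix D assume D: "D \<in> marked_diagrams m (Suc r)"
    show "D \<in> marked_diagrams m r \<union> ?f ` (marked_diagrams m r \<times> {1..m})"
    proof (cases "\<exists>j. (j, Suc r) \<in> D")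
      case True
      then obtain j where j: "(j, Suc r) \<in> D" by blast
      have "j \<in> {1..m}" using D j by (auto simp: marked_diagrams_def)
      moreover have "D - {(j, Suc r)} \<in> marked_diagrams m r"
        using D j unfolding marked_diagrams_def by (auto simp: le_Suc_eq)
      moreover have "D = ?f (D - {(j, Suc r)}, j)" using j by auto
      ultimately show ?thesis by blast
    next
      case False
      have "b \<le> r" if "(a, b) \<in> D" for a b
        using D False that unfolding marked_diagrams_def by (force simp: le_Suc_eq)
      then have "D \<in> marked_diagrams m r"
        using D unfolding marked_diagrams_def by fastforce
      then show ?thesis by blast
    qed
  next
    fix D assume "D \<in> marked_diagrams m r \<union> ?f ` (marked_diagrams m r \<times> {1..m})"
    then show "D \<in> marked_diagrams m (Suc r)"
      by (auto simp: marked_diagrams_def)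
  qed
  moreover have "marked_diagrams m r \<inter> ?f ` (marked_diagrams m r \<times> {1..m}) = {}"
    using new by auto
  moreover have "inj_on ?f (marked_diagrams m r \<times> {1..m})"
  proof (rule inj_onI, clarify)
    fix D j D' j' assume D: "D \<in> marked_diagrams m r" "D' \<in> marked_diagrams m r"
      and eq: "insert (j, Suc r) D = insert (j', Suc r) D'"
    have "j = j'" using eq new[OF D(2), of j] by blast
    then show "D = D' \<and> j = j'" using eq new[OF D(1)] new[OF D(2)] by (metis insert_ident)
  qed
  ultimately have "(\<Sum>D\<in>marked_diagrams m (Suc r). h D) = (\<Sum>D\<in>marked_diagrams m r. h D) +
      (\<Sum>(D, j)\<in>marked_diagrams m r \<times> {1..m}. h (insert (j, Suc r) D))"
    using fin by (simp add: sum.union_disjoint sum.reindex case_prod_unfold)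
  then show ?thesis by (simp add: sum.distrib sum.cartesian_product)
qed

text \<open>
  The factor from row \<open>i\<close> of \<open>Y_D\<close> is odd exactly if column \<open>i\<close> is marked, and each marked column
  has one marked box.
\<close>

lemma has_parity_Y_prod:
  assumes "D \<in> marked_diagrams m r"
  shows "has_parity (odd (card D)) (prod_list (map (\<lambda>i. Y_mat D i (\<sigma> i)) [1..<Suc r]))"
proof -
  have "has_parity (odd (card {i \<in> set [1..<Suc r]. \<exists>j. (j, i) \<in> D}))
      (prod_list (map (\<lambda>i. Y_mat D i (\<sigma> i)) [1..<Suc r]))"
    by (intro has_parity_prod_list) (auto simp: Y_mat_def)
  moreover have "{i \<in> set [1..<Suc r]. \<exists>j. (j, i) \<in> D} = snd ` D"
    using assms unfolding marked_diagrams_def by force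
  moreover have "card (snd ` D) = card D"
    using assms by (intro card_image) (auto simp: inj_on_def marked_diagrams_def)
  ultimately show ?thesis by (simp del: upt_Suc)
qed

lemma marked_diagrams_column_empty:
  "D \<in> marked_diagrams m r \<Longrightarrow> r < i \<Longrightarrow> (j, i) \<notin> D"
  by (auto simp: marked_diagrams_def)

text \<open>
  Write the product of \<open>det X_D\<close> with one term of \<open>det Y_D\<close> as \<open>(a\<^sub>1 \<dots> a\<^sub>r) (b\<^sub>1 \<dots> b\<^sub>r)\<close>, where
  \<open>a\<^sub>i\<close> and \<open>b\<^sub>i\<close> are odd if column \<open>i\<close> is marked and even otherwise.  Rearranging it as
  \<open>(a\<^sub>1 b\<^sub>1) \<dots> (a\<^sub>r b\<^sub>r)\<close> exchanges every pair of marked columns once, so the sign is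
  \<open>(- 1) ^ (d * (d - 1) div 2)\<close> for \<open>d = card D\<close>, which is the sign in \<open>\<Gamma>\<^sub>r\<close>.  After that, the
  sum over \<open>D\<close> factors into sums over the markings of the single columns, and these are the
  expansions of the bordered determinants.
\<close>

lemma marked_sum_eq_prod_border_det:
  "(\<Sum>D\<in>marked_diagrams m r. (- 1) ^ (card D * (card D - 1) div 2) *
      (det_X m r D * prod_list (map (\<lambda>i. Y_mat D i (\<sigma> i)) [1..<Suc r]))) =
    prod_list (map (\<lambda>i. border_det m i (\<sigma> i)) [1..<Suc r])"
proof (induction r)
  case 0
  show ?case by (simp add: marked_diagrams_0 det_X_def)
next
  case (Suc r)
  define s :: "(nat \<times> nat) set \<Rightarrow> superpoly" where "s D = (- 1) ^ (card D * (card D - 1) div 2)" for D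
  define Y where "Y r D = prod_list (map (\<lambda>i. Y_mat D i (\<sigma> i)) [1..<Suc r])" for r D
  let ?X = "\<lambda>j. rdet m (\<lambda>i c. if i = j then etav (Suc r) c else xv i c)" and ?k = "\<sigma> (Suc r)"
  have det_X_Suc: "det_X m (Suc r) D = det_X m r D * rdet m (X_mat D (Suc r))" for D
    by (simp add: det_X_def)
  have Y_Suc: "Y (Suc r) D = Y r D * Y_mat D (Suc r) ?k" for D
    by (simp add: Y_def)
  have unmarked: "s D * (det_X m (Suc r) D * Y (Suc r) D) =
      s D * (det_X m r D * Y r D) * (rdet m xv * yv (Suc r) ?k)" if D: "D \<in> marked_diagrams m r" for D
  proof -
    have "X_mat D (Suc r) = xv" "Y_mat D (Suc r) ?k = yv (Suc r) ?k"
      using marked_diagrams_column_empty[OF D] by (auto simp: X_mat_def Y_mat_def fun_eq_iff)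
    moreover have "rdet m xv * Y r D = Y r D * rdet m xv"
      unfolding Y_def by (rule even_commute[OF has_parity_X has_parity_Y_prod[OF D]])
    ultimately show ?thesis
      by (simp add: det_X_Suc Y_Suc mult.assoc) (simp flip: mult.assoc)
  qed
  have marked: "s (insert (j, Suc r) D) * (det_X m (Suc r) (insert (j, Suc r) D)
        * Y (Suc r) (insert (j, Suc r) D)) =
      s D * (det_X m r D * Y r D) * (?X j * xiv j ?k)"
    if D: "D \<in> marked_diagrams m r" and j: "j \<in> {1..m}" for D j
  proof -
    let ?D = "insert (j, Suc r) D"
    have notin: "(i, Suc r) \<notin> D" for i using marked_diagrams_column_empty[OF D] by simp
    have fin: "finite D" using D by (auto simp: marked_diagrams_def intro: finite_subset)
    have X: "X_mat ?D (Suc r) = (\<lambda>i c. if i = j then etav (Suc r) c else xv i c)"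
      "Y_mat ?D (Suc r) ?k = xiv j ?k"
      using notin by (auto simp: X_mat_def Y_mat_def fun_eq_iff)
    have "X_mat ?D i = X_mat D i" "Y_mat ?D i = Y_mat D i" if "i \<in> set [1..<Suc r]" for i
      using that by (auto simp: X_mat_def Y_mat_def fun_eq_iff)
    then have old: "det_X m r ?D = det_X m r D" "Y r ?D = Y r D"
      unfolding det_X_def Y_def
      by (intro arg_cong[of _ _ prod_list] map_cong refl; simp del: upt_Suc)+
    \<comment> \<open>The new odd factor is moved past the \<open>d\<close> odd factors of the product over \<open>Y\<close>.\<close>
    have "Suc d * d = d * (d - 1) + 2 * d" for d :: nat by (cases d) auto
    then have "Suc d * d div 2 = d * (d - 1) div 2 + d" for d :: nat by simp
    then have s: "s ?D = s D * (- 1) ^ card D"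
      using notin fin by (simp add: s_def power_add)
    have "?X j * Y r D = (- 1) ^ card D * (Y r D * ?X j)"
      using supercommute[OF has_parity_X_replaced[OF j] has_parity_Y_prod[OF D]]
      unfolding Y_def by (simp add: minus_one_power_iff)
    then have "det_X m (Suc r) ?D * Y (Suc r) ?D =
        det_X m r D * ((- 1) ^ card D * (Y r D * ?X j)) * xiv j ?k"
      by (simp add: det_X_Suc Y_Suc old X mult.assoc) (simp flip: mult.assoc)
    then show ?thesis
      by (simp add: s minus_one_power_iff mult.assoc)
  qed
  have "(\<Sum>D\<in>marked_diagrams m (Suc r). s D * (det_X m (Suc r) D * Y (Suc r) D)) =
      (\<Sum>D\<in>marked_diagrams m r. s D * (det_X m r D * Y r D)) * border_det m (Suc r) ?k"
    unfolding sum_marked_diagrams_Suc border_det_expand sum_distrib_right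
    by (intro sum.cong refl) (simp add: unmarked marked distrib_left sum_distrib_left del: upt_Suc)
  also have "\<dots> = prod_list (map (\<lambda>i. border_det m i (\<sigma> i)) [1..<Suc (Suc r)])"
    using Suc.IH by (simp add: s_def Y_def)
  finally show ?case by (simp only: s_def Y_def)
qed

lemma Gamma_vec_eq_rdet: "Gamma_vec m r = rdet r (border_det m)"
proof -
  let ?s = "\<lambda>D. (- 1) ^ (card D * (card D - 1) div 2) :: superpoly"
  let ?Y = "\<lambda>D \<sigma>. prod_list (map (\<lambda>i. Y_mat D i (\<sigma> i)) [1..<Suc r])"
  have "Gamma_vec m r = (\<Sum>D\<in>marked_diagrams m r. \<Sum>\<sigma> | \<sigma> permutes {1..r}.
      of_int (sign \<sigma>) * (?s D * (det_X m r D * ?Y D \<sigma>)))"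
    unfolding Gamma_vec_def Delta_def rdet_def sum_distrib_left
    by (intro sum.cong refl) (simp add: sign_def)
  also have "\<dots> = (\<Sum>\<sigma> | \<sigma> permutes {1..r}. of_int (sign \<sigma>) *
      (\<Sum>D\<in>marked_diagrams m r. ?s D * (det_X m r D * ?Y D \<sigma>)))"
    unfolding sum_distrib_left by (rule sum.swap)
  also have "\<dots> = rdet r (border_det m)"
    unfolding marked_sum_eq_prod_border_det rdet_def ..
  finally show ?thesis .
qed

section \<open>The root and Cartan operators on the bordered determinants\<close>

lemma superderivation_summands:
  "superderivation False (\<lambda>f. xv j i * dx l k f)"
  "superderivation False (\<lambda>f. yv j i * dy l k f)"
  "superderivation False (\<lambda>f. xiv j i * dxi l k f)"
  "superderivation False (\<lambda>f. etav j i * deta l k f)"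
  "superderivation True (\<lambda>f. xv j i * dxi l k f)"
  "superderivation True (\<lambda>f. xv j i * deta l k f)"
  "superderivation True (\<lambda>f. etav j i * dy l k f)"
  "superderivation True (\<lambda>f. xiv j i * dy l k f)"
  using superderivation_mult_left[OF has_parity_generators(1)[of j i] superderivation_even_deriv(1)[of l k]]
    superderivation_mult_left[OF has_parity_generators(2)[of j i] superderivation_even_deriv(2)[of l k]]
    superderivation_mult_left[OF has_parity_generators(3)[of j i] superderivation_odd_deriv(1)[of l k]]
    superderivation_mult_left[OF has_parity_generators(4)[of j i] superderivation_odd_deriv(2)[of l k]]
    superderivation_mult_left[OF has_parity_generators(1)[of j i] superderivation_odd_deriv(1)[of l k]]
    superderivation_mult_left[OF has_parity_generators(1)[of j i] superderivation_odd_deriv(2)[of l k]]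
    superderivation_mult_left[OF has_parity_generators(4)[of j i] superderivation_even_deriv(2)[of l k]]
    superderivation_mult_left[OF has_parity_generators(3)[of j i] superderivation_even_deriv(2)[of l k]]
  by simp_all

lemma superderivation_operators:
  "superderivation False (pq_cartan_even m n i)"
  "superderivation False (pq_cartan_odd m n i)"
  "superderivation False (mn_cartan_even p q i)"
  "superderivation False (mn_cartan_odd p q i)"
  "superderivation False (pq_root_even m n i)"
  "superderivation False (pq_root_odd m n i)"
  "superderivation True (pq_root_mixed p m n)"
  "superderivation False (mn_root_even p q i)"
  "superderivation False (mn_root_odd p q i)"
  "superderivation True (mn_root_mixed m p q)"
  unfolding pq_cartan_even_def[abs_def] pq_cartan_odd_def[abs_def] mn_cartan_even_def[abs_def]
    mn_cartan_odd_def[abs_def] pq_root_even_def[abs_def] pq_root_odd_def[abs_def]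
    pq_root_mixed_def[abs_def] mn_root_even_def[abs_def] mn_root_odd_def[abs_def]
    mn_root_mixed_def[abs_def]
  by (intro superderivation_plus superderivation_minus superderivation_Sum superderivation_summands)+

lemma sum_select:
  fixes g :: "nat \<Rightarrow> 'a::semiring_1"
  shows "(\<Sum>j=Suc 0..N. g j * (if a = j then 1 else 0)) = (if a \<in> {1..N} then g a else 0)"
    and "(\<Sum>j=Suc 0..N. g j * (if a = j \<and> P then 1 else 0)) =
      (if a \<in> {1..N} \<and> P then g a else 0)"
    and "(\<Sum>j=Suc 0..N. g j * (if P \<and> a = j then 1 else 0)) =
      (if a \<in> {1..N} \<and> P then g a else 0)"
  by (cases P; simp add: if_distrib[of "(*) _"] cong: if_cong)+

lemmas operator_simps = pq_cartan_even_def pq_cartan_odd_def mn_cartan_even_def mn_cartan_odd_def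
  pq_root_even_def pq_root_odd_def pq_root_mixed_def mn_root_even_def mn_root_odd_def
  mn_root_mixed_def deriv_generators sum_select

lemma has_parity_bordered: "has_parity ((i \<le> m) \<noteq> (j \<le> m)) (bordered m a k i j)"
  by (simp add: bordered_def)

text \<open>
  A row other than the last has a single odd entry, the one in the last column.
\<close>

lemma bordered_row_commute:
  assumes "i \<le> m" "j \<in> {1..Suc m}" "j' \<in> {1..Suc m}" "j \<noteq> j'"
  shows "bordered m a k i j * bordered m a k i j' = bordered m a k i j' * bordered m a k i j"
proof -
  have "j \<le> m \<or> j' \<le> m" using assms by auto
  then show ?thesis
    using even_commute[of "bordered m a k i j" _ "bordered m a k i j'"]
      even_commute[of "bordered m a k i j'" _ "bordered m a k i j"]
      has_parity_bordered[of i m j a k] has_parity_bordered[of i m j' a k] assms(1) by auto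
qed

lemma border_det_0:
  assumes "superderivation d D"
    "\<And>i j. i \<in> {1..Suc m} \<Longrightarrow> j \<in> {1..Suc m} \<Longrightarrow> D (bordered m a k i j) = 0"
  shows "D (border_det m a k) = 0"
  unfolding border_det_def
proof (rule superderivation_rdet_0[OF assms(1)])
  show "has_parity ((i \<le> m) \<noteq> (j \<le> m)) (bordered m a k i j)" for i j
    by (rule has_parity_bordered)
qed (rule assms(2))

text \<open>
  The restriction on odd operators keeps the entries that they are moved past even: above the last
  row, the only odd entries of a bordered matrix are in the last column.
\<close>

lemma border_det_column:
  assumes D: "superderivation d D" and c: "c \<in> {1..Suc m}"
    and zero: "\<And>i j. i \<in> {1..Suc m} \<Longrightarrow> j \<in> {1..Suc m} \<Longrightarrow> j \<noteq> c \<Longrightarrow> D (bordered m a k i j) = 0"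
    and column: "\<And>i. i \<in> {1..Suc m} \<Longrightarrow> D (bordered m a k i c) = B i"
    and odd: "d \<Longrightarrow> c = Suc m"
  shows "D (border_det m a k) = rdet (Suc m) (\<lambda>i j. if j = c then B i else bordered m a k i j)"
proof -
  have "D (border_det m a k) =
      rdet (Suc m) (\<lambda>i j. if j = c then D (bordered m a k i j) else bordered m a k i j)"
    unfolding border_det_def
  proof (rule superderivation_rdet_column[OF D c, of "\<lambda>i j. (i \<le> m) \<noteq> (j \<le> m)"])
    show "has_parity ((i \<le> m) \<noteq> (j \<le> m)) (bordered m a k i j)" for i j
      by (rule has_parity_bordered)
    show "\<not> (i \<le> m) \<noteq> (j \<le> m)" if "i \<in> {1..<Suc m}" "j \<in> {1..Suc m}" "j \<noteq> c" d for i j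
      using that odd by auto
  qed (use zero in auto)
  also have "\<dots> = rdet (Suc m) (\<lambda>i j. if j = c then B i else bordered m a k i j)"
    by (intro rdet_cong) (simp add: column)
  finally show ?thesis .
qed

lemma border_det_column_equal:
  assumes D: "superderivation d D" and c: "c \<in> {1..Suc m}" "c' \<in> {1..Suc m}" "c' \<noteq> c"
    and zero: "\<And>i j. i \<in> {1..Suc m} \<Longrightarrow> j \<in> {1..Suc m} \<Longrightarrow> j \<noteq> c \<Longrightarrow> D (bordered m a k i j) = 0"
    and column: "\<And>i. i \<in> {1..Suc m} \<Longrightarrow> D (bordered m a k i c) = bordered m a k i c'"
    and odd: "d \<Longrightarrow> c = Suc m"
  shows "D (border_det m a k) = 0"
proof -
  have "D (border_det m a k) =
      rdet (Suc m) (\<lambda>i j. if j = c then bordered m a k i c' else bordered m a k i j)"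
    by (rule border_det_column[OF D c(1)]) (simp_all add: zero column odd)
  also have "\<dots> = 0"
    by (rule superpoly_double_zero, rule rdet_equal_columns[OF c(1,2)]) (use c in auto)
  finally show ?thesis .
qed

lemma border_det_row:
  assumes D: "superderivation False D" and s: "s \<in> {1..Suc m}"
    and zero: "\<And>i j. i \<in> {1..Suc m} \<Longrightarrow> j \<in> {1..Suc m} \<Longrightarrow> i \<noteq> s \<Longrightarrow> D (bordered m a k i j) = 0"
    and row: "\<And>j. j \<in> {1..Suc m} \<Longrightarrow> D (bordered m a k s j) = B j"
  shows "D (border_det m a k) = rdet (Suc m) (\<lambda>i j. if i = s then B j else bordered m a k i j)"
proof -
  have "D (border_det m a k) =
      rdet (Suc m) (\<lambda>i j. if i = s then D (bordered m a k i j) else bordered m a k i j)"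
    unfolding border_det_def
  proof (rule derivation_rdet_row[OF D s])
    show "has_parity ((i \<le> m) \<noteq> (j \<le> m)) (bordered m a k i j)" for i j
      by (rule has_parity_bordered)
  qed (simp_all add: zero)
  also have "\<dots> = rdet (Suc m) (\<lambda>i j. if i = s then B j else bordered m a k i j)"
    by (intro rdet_cong) (simp add: row)
  finally show ?thesis .
qed

lemma pq_cartan_even_border_det:
  assumes "a \<in> {1..n}" "i \<in> {1..m}"
  shows "pq_cartan_even m n i (border_det m a k) = border_det m a k"
proof -
  have "pq_cartan_even m n i (border_det m a k) =
      rdet (Suc m) (\<lambda>l j. if j = i then bordered m a k l i else bordered m a k l j)"
    using assms
    by (intro border_det_column[OF superderivation_operators(1)]) (auto simp: bordered_def operator_simps)
  also have "\<dots> = border_det m a k"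
    unfolding border_det_def by (intro rdet_cong) auto
  finally show ?thesis .
qed

lemma mn_cartan_even_border_det:
  assumes "k \<in> {1..q}" "s \<in> {1..m}"
  shows "mn_cartan_even m q s (border_det m a k) = border_det m a k"
proof -
  have "mn_cartan_even m q s (border_det m a k) =
      rdet (Suc m) (\<lambda>l j. if l = s then bordered m a k s j else bordered m a k l j)"
    using assms
    by (intro border_det_row[OF superderivation_operators(3)]) (auto simp: bordered_def operator_simps)
  also have "\<dots> = border_det m a k"
    unfolding border_det_def by (intro rdet_cong) auto
  finally show ?thesis .
qed

lemma pq_root_even_border_det:
  assumes "a \<in> {1..n}" "i \<in> {1<..m}"
  shows "pq_root_even m n i (border_det m a k) = 0"
  using assms
  by (intro border_det_column_equal[OF superderivation_operators(5), where c = i and c' = "i - 1"])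
    (auto simp: bordered_def operator_simps)

text \<open>
  For \<open>k = 1\<close> this odd operator replaces the last column by the column before it.
\<close>

lemma pq_root_mixed_border_det:
  assumes "a \<in> {1..n}" "1 \<le> m"
  shows "pq_root_mixed m m n (border_det m a k) = 0"
proof (cases "k = 1")
  case True
  then show ?thesis
    using assms
    by (intro border_det_column_equal[OF superderivation_operators(7), where c = "Suc m" and c' = m])
      (auto simp: bordered_def operator_simps)
next
  case False
  then show ?thesis
    by (intro border_det_0[OF superderivation_operators(7)]) (auto simp: bordered_def operator_simps)
qed

text \<open>
  The upper odd index \<open>k\<close> occurs in the last column only, so an operator that replaces it by \<open>k'\<close>
  does the same to the determinant.  With \<open>k' = k\<close> this serves the Cartan operators, with
  \<open>k' = k - 1\<close> the root vectors.
\<close>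

lemma border_det_upper_shift:
  assumes D: "superderivation False D"
    and zero: "\<And>l j. l \<le> m \<Longrightarrow> D (xv l j) = 0" "\<And>j. D (etav a j) = 0"
    and shift: "\<And>l. l \<in> {1..m} \<Longrightarrow> D (xiv l k) = xiv l k'" "D (yv a k) = yv a k'"
  shows "D (border_det m a k) = border_det m a k'"
proof -
  have "D (border_det m a k) =
      rdet (Suc m) (\<lambda>l j. if j = Suc m then bordered m a k' l (Suc m) else bordered m a k l j)"
    by (intro border_det_column[OF D]) (auto simp: bordered_def zero shift)
  also have "\<dots> = border_det m a k'"
    unfolding border_det_def by (intro rdet_cong) (auto simp: bordered_def)
  finally show ?thesis .
qed

lemma pq_cartan_odd_border_det:
  assumes "a \<in> {1..n}"
  shows "pq_cartan_odd m n l (border_det m a k) = (if k = l then border_det m a k else 0)"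
proof (cases "k = l")
  case True
  with assms show ?thesis
    by (simp del: One_nat_def, intro border_det_upper_shift[OF superderivation_operators(2)])
      (auto simp: operator_simps)
next
  case False
  then show ?thesis
    by (simp, intro border_det_0[OF superderivation_operators(2)]) (auto simp: bordered_def operator_simps)
qed

lemma pq_root_odd_border_det:
  assumes "a \<in> {1..n}"
  shows "pq_root_odd m n l (border_det m a k) = (if k = l then border_det m a (l - 1) else 0)"
proof (cases "k = l")
  case True
  with assms show ?thesis
    by (simp del: One_nat_def, intro border_det_upper_shift[OF superderivation_operators(6)])
      (auto simp: operator_simps)
next
  case False
  then show ?thesis
    by (simp, intro border_det_0[OF superderivation_operators(6)]) (auto simp: bordered_def operator_simps)
qed

text \<open>
  The counterpart for the lower index \<open>a\<close>, which occurs in the last row only.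
\<close>

lemma border_det_lower_shift:
  assumes D: "superderivation False D"
    and zero: "\<And>l j. l \<le> m \<Longrightarrow> D (xv l j) = 0" "\<And>l. D (xiv l k) = 0"
    and shift: "\<And>j. j \<in> {1..m} \<Longrightarrow> D (etav a j) = etav a' j" "D (yv a k) = yv a' k"
  shows "D (border_det m a k) = border_det m a' k"
proof -
  have "D (border_det m a k) =
      rdet (Suc m) (\<lambda>l j. if l = Suc m then bordered m a' k (Suc m) j else bordered m a k l j)"
    by (intro border_det_row[OF D]) (auto simp: bordered_def zero shift)
  also have "\<dots> = border_det m a' k"
    unfolding border_det_def by (intro rdet_cong) (auto simp: bordered_def)
  finally show ?thesis .
qed

lemma mn_cartan_odd_border_det:
  assumes "k \<in> {1..q}"
  shows "mn_cartan_odd m q b (border_det m a k) = (if a = b then border_det m a k else 0)"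
proof (cases "a = b")
  case True
  with assms show ?thesis
    by (simp del: One_nat_def, intro border_det_lower_shift[OF superderivation_operators(4)])
      (auto simp: operator_simps)
next
  case False
  then show ?thesis
    by (simp, intro border_det_0[OF superderivation_operators(4)]) (auto simp: bordered_def operator_simps)
qed

lemma mn_root_odd_border_det:
  assumes "k \<in> {1..q}"
  shows "mn_root_odd m q b (border_det m a k) = (if a = b then border_det m (b - 1) k else 0)"
proof (cases "a = b")
  case True
  with assms show ?thesis
    by (simp del: One_nat_def, intro border_det_lower_shift[OF superderivation_operators(9)])
      (auto simp: operator_simps)
next
  case False
  then show ?thesis
    by (simp, intro border_det_0[OF superderivation_operators(9)]) (auto simp: bordered_def operator_simps)
qed

lemma mn_root_even_border_det:
  assumes "k \<in> {1..q}" "s \<in> {1<..m}"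
  shows "mn_root_even m q s (border_det m a k) = 0"
proof -
  obtain t where t: "s = Suc t" "1 \<le> t" "t < m" using assms(2) by (cases s) auto
  have "mn_root_even m q s (border_det m a k) =
      rdet (Suc m) (\<lambda>i j. if i = s then bordered m a k t j else bordered m a k i j)"
    using assms t
    by (intro border_det_row[OF superderivation_operators(8)]) (auto simp: bordered_def operator_simps)
  moreover have "\<dots> = 0"
    by (rule superpoly_double_zero, rule rdet_equal_rows[of t])
      (use t in \<open>auto simp: bordered_row_commute\<close>)
  ultimately show ?thesis by simp
qed

text \<open>
  For \<open>a = 1\<close> the operator turns the last row into row \<open>m\<close>, up to signs.  It is odd and has to be moved
  past the factors from the first \<open>m\<close> rows.  Their product is odd exactly if it contains a \<open>\<xi>\<close>, that
  is, if the factor from the last row is an \<open>\<eta>\<close>; then the sign is negative.  Otherwise that factor is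
  \<open>y_1^k\<close>, where the sign is built into the operator.  So all terms acquire the same sign, and the result
  is the negative of a determinant with two equal adjacent rows.
\<close>

lemma mn_root_mixed_border_det:
  assumes "k \<in> {1..q}" "1 \<le> m"
  shows "mn_root_mixed m m q (border_det m a k) = 0"
proof (cases "a = 1")
  case False
  then show ?thesis
    by (intro border_det_0[OF superderivation_operators(10)]) (auto simp: bordered_def operator_simps)
next
  case True
  let ?D = "mn_root_mixed m m q" and ?B = "bordered m a k"
  let ?C = "\<lambda>i j. if i = Suc m then ?B m j else ?B i j"
  note D = superderivation_operators(10)[of m m q]
  have upt: "[1..<Suc (Suc m)] = [1..<Suc m] @ [Suc m]" by simp
  have "?D (prod_list (map (\<lambda>i. ?B i (\<sigma> i)) [1..<Suc (Suc m)])) =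
      - prod_list (map (\<lambda>i. ?C i (\<sigma> i)) [1..<Suc (Suc m)])"
    if \<sigma>: "\<sigma> permutes {1..Suc m}" for \<sigma>
  proof -
    let ?P = "prod_list (map (\<lambda>i. ?B i (\<sigma> i)) [1..<Suc m])"
    have "?D ?P = 0"
      by (rule superderivation_prod_list_0[OF D, of _ "\<lambda>i. (i \<le> m) \<noteq> (\<sigma> i \<le> m)"])
        (auto intro: has_parity_bordered simp: bordered_def operator_simps)
    have range: "\<sigma> i \<in> {1..Suc m}" if "i \<in> {1..Suc m}" for i
      using \<sigma> that by (simp only: permutes_in_image)
    \<comment> \<open>The last column is used by exactly one row.\<close>
    have "odd (card {i \<in> set [1..<Suc m]. (i \<le> m) \<noteq> (\<sigma> i \<le> m)}) = (\<sigma> (Suc m) \<le> m)"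
    proof -
      let ?i = "inv \<sigma> (Suc m)"
      have iff: "\<sigma> i = Suc m \<longleftrightarrow> i = ?i" for i
        using \<sigma> by (metis permutes_inverses)
      have i: "?i \<in> {1..Suc m}"
        using permutes_in_image[OF permutes_inv[OF \<sigma>], of "Suc m"] by simp
      have eq: "{i \<in> set [1..<Suc m]. (i \<le> m) \<noteq> (\<sigma> i \<le> m)} = {i \<in> {1..m}. \<sigma> i = Suc m}"
        using range by (force simp: not_le)
      show ?thesis
      proof (cases "\<sigma> (Suc m) \<le> m")
        case True
        then have "?i \<noteq> Suc m" using iff[of "Suc m"] by auto
        then have "{i \<in> {1..m}. \<sigma> i = Suc m} = {?i}" using i iff by auto
        then show ?thesis using True by (simp only: eq) simp
      next
        case False
        then have "\<sigma> (Suc m) = Suc m" using range[of "Suc m"] by auto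
        then have "?i = Suc m" using iff by simp
        then have "{i \<in> {1..m}. \<sigma> i = Suc m} = {}" using iff by auto
        then show ?thesis using False by (simp only: eq) simp
      qed
    qed
    moreover have "has_parity (odd (card {i \<in> set [1..<Suc m]. (i \<le> m) \<noteq> (\<sigma> i \<le> m)})) ?P"
      by (intro has_parity_prod_list has_parity_bordered) simp
    ultimately have "has_parity (\<sigma> (Suc m) \<le> m) ?P" by simp
    moreover have "?D (?B (Suc m) j) = (if j \<le> m then ?B m j else - ?B m j)" if "j \<in> {1..Suc m}" for j
      using that True assms by (auto simp: bordered_def operator_simps)
    ultimately have "?D (?P * ?B (Suc m) (\<sigma> (Suc m))) = - (?P * ?B m (\<sigma> (Suc m)))"
      using range[of "Suc m"] \<open>?D ?P = 0\<close> by (simp add: superderivation_leibniz[OF D] del: upt_Suc)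
    moreover have "map (\<lambda>i. ?C i (\<sigma> i)) [1..<Suc m] = map (\<lambda>i. ?B i (\<sigma> i)) [1..<Suc m]"
      by (intro map_cong) auto
    ultimately show ?thesis unfolding upt by (simp del: upt_Suc map_eq_conv)
  qed
  then have "?D (border_det m a k) = - rdet (Suc m) ?C"
    by (simp add: border_det_def rdet_def superderivation_sum[OF D] superderivation_sign[OF D] sum_negf
        del: upt_Suc)
  moreover have "rdet (Suc m) ?C = 0"
    by (rule superpoly_double_zero, rule rdet_equal_rows[of m])
      (use assms in \<open>auto simp: bordered_row_commute\<close>)
  ultimately show ?thesis by simp
qed

section \<open>The highest weight property\<close>

lemma Gamma_vec_0:
  assumes "superderivation d D" "\<And>a k. a \<in> {1..r} \<Longrightarrow> k \<in> {1..r} \<Longrightarrow> D (border_det m a k) = 0"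
  shows "D (Gamma_vec m r) = 0"
  unfolding Gamma_vec_eq_rdet
  by (rule superderivation_rdet_0[OF assms(1), of _ "\<lambda>_ _. False"])
    (auto intro: has_parity_border_det assms(2))

lemma Gamma_vec_column:
  assumes D: "superderivation False D" and l: "l \<in> {1..r}"
    and col: "\<And>a k. a \<in> {1..r} \<Longrightarrow> k \<in> {1..r} \<Longrightarrow>
      D (border_det m a k) = (if k = l then border_det m a l' else 0)"
  shows "D (Gamma_vec m r) = rdet r (\<lambda>a k. if k = l then border_det m a l' else border_det m a k)"
proof -
  have "D (Gamma_vec m r) =
      rdet r (\<lambda>a k. if k = l then D (border_det m a k) else border_det m a k)"
    unfolding Gamma_vec_eq_rdet
    by (rule superderivation_rdet_column[OF D l, of "\<lambda>_ _. False"])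
      (auto intro: has_parity_border_det simp: col)
  also have "\<dots> = rdet r (\<lambda>a k. if k = l then border_det m a l' else border_det m a k)"
    by (intro rdet_cong) (simp add: col)
  finally show ?thesis .
qed

lemma Gamma_vec_row:
  assumes D: "superderivation False D" and b: "b \<in> {1..r}"
    and row: "\<And>a k. a \<in> {1..r} \<Longrightarrow> k \<in> {1..r} \<Longrightarrow>
      D (border_det m a k) = (if a = b then border_det m b' k else 0)"
  shows "D (Gamma_vec m r) = rdet r (\<lambda>a k. if a = b then border_det m b' k else border_det m a k)"
proof -
  have "D (Gamma_vec m r) =
      rdet r (\<lambda>a k. if a = b then D (border_det m a k) else border_det m a k)"
    unfolding Gamma_vec_eq_rdet
    by (rule derivation_rdet_row[OF D b, of "\<lambda>_ _. False"])
      (auto intro: has_parity_border_det simp: row)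
  also have "\<dots> = rdet r (\<lambda>a k. if a = b then border_det m b' k else border_det m a k)"
    by (intro rdet_cong) (simp add: row)
  finally show ?thesis .
qed

lemma Gamma_vec_eigen:
  assumes "superderivation False D"
    "\<And>a k. a \<in> {1..r} \<Longrightarrow> k \<in> {1..r} \<Longrightarrow> D (border_det m a k) = border_det m a k"
  shows "D (Gamma_vec m r) = of_nat r * Gamma_vec m r"
  unfolding Gamma_vec_eq_rdet
  by (rule derivation_rdet_eigen[OF assms(1), of _ "\<lambda>_ _. False"])
    (auto intro: has_parity_border_det assms(2))

lemma pq_weight_Gamma_vec:
  assumes "r \<le> n"
  shows "i \<in> {1..m} \<Longrightarrow> pq_cartan_even m n i (Gamma_vec m r) = of_nat r * Gamma_vec m r"
    and "1 \<le> l \<Longrightarrow> pq_cartan_odd m n l (Gamma_vec m r) = of_nat (if l \<le> r then 1 else 0) * Gamma_vec m r"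
proof -
  show "pq_cartan_even m n i (Gamma_vec m r) = of_nat r * Gamma_vec m r" if "i \<in> {1..m}"
    using assms that
    by (intro Gamma_vec_eigen superderivation_operators pq_cartan_even_border_det) auto
  show "pq_cartan_odd m n l (Gamma_vec m r) = of_nat (if l \<le> r then 1 else 0) * Gamma_vec m r"
    if l: "1 \<le> l"
  proof (cases "l \<le> r")
    case True
    have "pq_cartan_odd m n l (Gamma_vec m r) =
        rdet r (\<lambda>a k. if k = l then border_det m a l else border_det m a k)"
      using assms True l
      by (intro Gamma_vec_column superderivation_operators) (auto simp: pq_cartan_odd_border_det)
    also have "\<dots> = Gamma_vec m r"
      unfolding Gamma_vec_eq_rdet by (intro rdet_cong) auto
    finally show ?thesis using True by simp
  next
    case False
    then show ?thesis
      using assms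
      by (simp, intro Gamma_vec_0[OF superderivation_operators(2)]) (auto simp: pq_cartan_odd_border_det)
  qed
qed

lemma mn_weight_Gamma_vec:
  assumes "r \<le> q"
  shows "s \<in> {1..m} \<Longrightarrow> mn_cartan_even m q s (Gamma_vec m r) = of_nat r * Gamma_vec m r"
    and "1 \<le> b \<Longrightarrow> mn_cartan_odd m q b (Gamma_vec m r) = of_nat (if b \<le> r then 1 else 0) * Gamma_vec m r"
proof -
  show "mn_cartan_even m q s (Gamma_vec m r) = of_nat r * Gamma_vec m r" if "s \<in> {1..m}"
    using assms that
    by (intro Gamma_vec_eigen superderivation_operators mn_cartan_even_border_det) auto
  show "mn_cartan_odd m q b (Gamma_vec m r) = of_nat (if b \<le> r then 1 else 0) * Gamma_vec m r"
    if b: "1 \<le> b"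
  proof (cases "b \<le> r")
    case True
    have "mn_cartan_odd m q b (Gamma_vec m r) =
        rdet r (\<lambda>a k. if a = b then border_det m b k else border_det m a k)"
      using assms True b
      by (intro Gamma_vec_row superderivation_operators) (auto simp: mn_cartan_odd_border_det)
    also have "\<dots> = Gamma_vec m r"
      unfolding Gamma_vec_eq_rdet by (intro rdet_cong) auto
    finally show ?thesis using True by simp
  next
    case False
    then show ?thesis
      using assms
      by (simp, intro Gamma_vec_0[OF superderivation_operators(4)]) (auto simp: mn_cartan_odd_border_det)
  qed
qed

lemma pq_annihilated_Gamma_vec:
  assumes "r \<le> n"
  shows "pq_annihilated m q m n (Gamma_vec m r)"
proof -
  have "pq_root_even m n i (Gamma_vec m r) = 0" if "i \<in> {1<..m}" for i
    using assms that
    by (intro Gamma_vec_0[OF superderivation_operators(5)] pq_root_even_border_det) auto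
  moreover have "pq_root_odd m n l (Gamma_vec m r) = 0" if l: "1 < l" for l
  proof (cases "l \<le> r")
    case True
    have "pq_root_odd m n l (Gamma_vec m r) =
        rdet r (\<lambda>a k. if k = l then border_det m a (l - 1) else border_det m a k)"
      using assms True l
      by (intro Gamma_vec_column superderivation_operators) (auto simp: pq_root_odd_border_det)
    also have "\<dots> = 0"
      by (rule superpoly_double_zero, rule rdet_equal_columns[of l _ "l - 1"]) (use True l in auto)
    finally show ?thesis .
  next
    case False
    then show ?thesis
      using assms
      by (intro Gamma_vec_0[OF superderivation_operators(6)]) (auto simp: pq_root_odd_border_det)
  qed
  moreover have "pq_root_mixed m m n (Gamma_vec m r) = 0" if "1 \<le> m"
    using assms that
    by (intro Gamma_vec_0[OF superderivation_operators(7)] pq_root_mixed_border_det) auto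
  ultimately show ?thesis by (simp add: pq_annihilated_def)
qed

lemma mn_annihilated_Gamma_vec:
  assumes "r \<le> q"
  shows "mn_annihilated m q m n (Gamma_vec m r)"
proof -
  have "mn_root_even m q s (Gamma_vec m r) = 0" if "s \<in> {1<..m}" for s
    using assms that
    by (intro Gamma_vec_0[OF superderivation_operators(8)] mn_root_even_border_det) auto
  moreover have "mn_root_odd m q b (Gamma_vec m r) = 0" if b: "1 < b" for b
  proof (cases "b \<le> r")
    case True
    obtain t where t: "b = Suc t" "1 \<le> t" using b by (cases b) auto
    have "mn_root_odd m q b (Gamma_vec m r) =
        rdet r (\<lambda>a k. if a = b then border_det m (b - 1) k else border_det m a k)"
      using assms True b
      by (intro Gamma_vec_row superderivation_operators) (auto simp: mn_root_odd_border_det)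
    also have "\<dots> = 0"
      by (rule superpoly_double_zero, rule rdet_equal_rows[of t])
        (use True t in \<open>auto intro: even_commute[OF has_parity_border_det has_parity_border_det]\<close>)
    finally show ?thesis .
  next
    case False
    then show ?thesis
      using assms
      by (intro Gamma_vec_0[OF superderivation_operators(9)]) (auto simp: mn_root_odd_border_det)
  qed
  moreover have "mn_root_mixed m m q (Gamma_vec m r) = 0" if "1 \<le> m"
    using assms that
    by (intro Gamma_vec_0[OF superderivation_operators(10)] mn_root_mixed_border_det) auto
  ultimately show ?thesis by (simp add: mn_annihilated_def)
qed

text \<open>
  Put \<open>x_l^i = 1\<close> for \<open>l = i\<close>, \<open>y_k^j = 1\<close> for \<open>k = j\<close> and all other variables \<open>0\<close>.  The matrix of the
  bordered determinants becomes the identity matrix, so \<open>\<Gamma>\<^sub>r\<close> takes the value \<open>1\<close>.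
\<close>

lemma Gamma_vec_nonzero: "Gamma_vec m r \<noteq> 0"
proof -
  define V where "V = range (\<lambda>i. EvX i i) \<union> range (\<lambda>i. EvY i i)"
  have "body_at V (border_det m a k) = (if a = k then 1 else 0)" for a k
  proof -
    have entries: "body_at V (bordered m a k i j) =
        (if i \<le> m \<and> j \<le> m \<and> i = j \<or> m < i \<and> m < j \<and> a = k then 1 else 0)" for i j
      by (auto simp: bordered_def xv_def yv_def xiv_def etav_def body_at_evgen body_at_godd V_def)
    have "body_at V (border_det m a k) = (\<Prod>i=1..Suc m. body_at V (bordered m a k i i))"
      unfolding border_det_def rdet_body_at by (rule rdet_diagonal) (auto simp: entries)
    then show ?thesis by (simp add: entries)
  qed
  then have "body_at V (Gamma_vec m r) = (\<Prod>i=1..r. 1)"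
    unfolding Gamma_vec_eq_rdet rdet_body_at by (subst rdet_diagonal) auto
  then show ?thesis by auto
qed

lemma Gamma_vec_superpolys:
  assumes "r \<le> q" "r \<le> n"
  shows "Gamma_vec m r \<in> superpolys m q m n"
  unfolding Gamma_vec_eq_rdet border_det_def
proof (intro superpolys_rdet)
  fix a k i j assume "a \<in> {1..r}" "k \<in> {1..r}" "i \<in> {1..Suc m}" "j \<in> {1..Suc m}"
  then show "bordered m a k i j \<in> superpolys m q m n"
    using assms by (auto simp: bordered_def intro!: superpolys_generators)
qed

theorem theorem4p3:
  fixes m n q r :: nat
  assumes "1 \<le> r" and "r \<le> min q n"
  shows "highest_weight_vector m q m n (Gamma_vec m r) \<and>
    corresponds_to m q m n (Gamma_vec m r) (rectangle (m + 1) r)"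
proof -
  let ?L = "rectangle (Suc m) r"
  have r: "r \<le> q" "r \<le> n" using assms(2) by auto
  have rows: "row_length ?L i = r" if "i \<in> {1..m}" for i
  proof -
    have "{j. (i, j) \<in> ?L} = {1..r}" using that by (auto simp: rectangle_def)
    then show ?thesis by (simp add: row_length_def)
  qed
  have columns: "pos_part (int (row_length (?L\<inverse>) l) - int m) = (if l \<le> r then 1 else 0)" if "1 \<le> l" for l
  proof -
    have "{j. (l, j) \<in> ?L\<inverse>} = (if l \<le> r then {1..Suc m} else {})"
      using that by (auto simp: rectangle_def)
    then show ?thesis by (simp add: row_length_def pos_part_def)
  qed
  have "young_diagram ?L"
    by (auto simp: young_diagram_def rectangle_def)
  moreover have "has_pq_weight m q m n (Gamma_vec m r) (\<lambda>i. of_nat (row_length ?L i))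
      (\<lambda>l. of_int (pos_part (int (row_length (?L\<inverse>) l) - int m)))"
    using pq_weight_Gamma_vec[OF r(2), where m = m] scal_of_nat[of 0] scal_of_nat[of 1]
    by (auto simp: has_pq_weight_def rows columns scal_of_nat)
  moreover have "has_mn_weight m q m n (Gamma_vec m r) (\<lambda>i. of_nat (row_length ?L i))
      (\<lambda>l. of_int (pos_part (int (row_length (?L\<inverse>) l) - int m)))"
    using mn_weight_Gamma_vec[OF r(1), where m = m] scal_of_nat[of 0] scal_of_nat[of 1]
    by (auto simp: has_mn_weight_def rows columns scal_of_nat)
  ultimately show ?thesis
    using Gamma_vec_superpolys[OF r] Gamma_vec_nonzero pq_annihilated_Gamma_vec[OF r(2)]
      mn_annihilated_Gamma_vec[OF r(1)]
    unfolding highest_weight_vector_def corresponds_to_def Suc_eq_plus1[symmetric] by blast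
qed

end
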